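(* Let $b \geq 3$ be an integer and let $D \subset \{0,1,\ldots,b-1\}$ with $2 \leq \#D \leq b-1$. Let $C(b,D)$ be the corresponding generalized Cantor set, with Hausdorff dimension $\gamma = \log \#D / \log b$. Let $m = \min\{ \min D,\ b-1-\max D \}$. Let $f$ be a dimension function such that $r \mapsto r^{-\gamma} f(r)$ is monotonic, and let $\psi : \mathbb{N} \to (0,\infty)$ be any function. Then $$\mathcal{H}^{f} (W_{b}(\psi) \cap C(b,D)) = \begin{cases} 0, &\text{ if } \displaystyle\sum_{n \geq 1 \colon \psi(n) > \frac{m}{(b-1)b^n}} f\left(\psi(n) - \frac{m}{(b-1)b^n}\right) b^{n \gamma} < \infty, \\[2ex] \mathcal{H}^{f}(C(b,D)), &\text{ if } \displaystyle\sum_{n \geq 1 \colon \psi(n) > \frac{m}{(b-1)b^n}} f\left(\psi(n) - \frac{m}{(b-1)b^n}\right) b^{n \gamma} = \infty. \end{cases}$$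
   Context: The generalized Cantor set $C(b,D)$ is the set of real numbers $x \in [0,1]$ whose base-$b$ expansion uses only digits from $D$. A dimension function is a continuous, non-decreasing function $f:(0,\infty)\to(0,\infty)$ with $\lim_{r\to 0} f(r)=0$; $\mathcal{H}^f$ is the Hausdorff $f$-measure. For an integer $t\ge 2$ and $\psi:\mathbb{N}\to(0,\infty)$, $W_{t}(\psi) = \{x \in [0,1] : |x - p/t^n| < \psi(n) \text{ for infinitely many } (p,n) \in \mathbb{N}^2\}$. *)

theory Defs
  imports "HOL-Analysis.Analysis"
begin

definition cantor_set :: "nat \<Rightarrow> nat set \<Rightarrow> real set" where
  "cantor_set b D = {x. \<exists>d :: nat \<Rightarrow> nat. (\<forall>n. d n \<in> D) \<and>
       x = (\<Sum>n. real (d n) / real b ^ (Suc n))}"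

definition dimension_function :: "(real \<Rightarrow> real) \<Rightarrow> bool" where
  "dimension_function f \<longleftrightarrow> continuous_on {0<..} f \<and> mono_on {0<..} f \<and>
     (\<forall>r>0. f r > 0) \<and> (f \<longlongrightarrow> 0) (at_right 0)"

text \<open>Cost of a covering set; sets of diameter 0 cost f(0+) = 0.\<close>
definition hf_cost :: "(real \<Rightarrow> real) \<Rightarrow> real set \<Rightarrow> ennreal" where
  "hf_cost f U = (if diameter U = 0 then 0 else ennreal (f (diameter U)))"

definition hausdorff_content :: "(real \<Rightarrow> real) \<Rightarrow> real \<Rightarrow> real set \<Rightarrow> ennreal" where
  "hausdorff_content f \<delta> E =
     (INF U \<in> {U :: nat \<Rightarrow> real set. E \<subseteq> (\<Union>i. U i) \<and>
                 (\<forall>i. bounded (U i) \<and> diameter (U i) \<le> \<delta>)}.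
        (\<Sum>i. hf_cost f (U i)))"

definition hausdorff_measure :: "(real \<Rightarrow> real) \<Rightarrow> real set \<Rightarrow> ennreal" where
  "hausdorff_measure f E = (SUP \<delta> \<in> {0<..}. hausdorff_content f \<delta> E)"

definition W_set :: "nat \<Rightarrow> (nat \<Rightarrow> real) \<Rightarrow> real set" where
  "W_set t \<psi> = {x \<in> {0..1}. infinite {(p :: nat, n :: nat). p \<ge> 1 \<and> n \<ge> 1 \<and>
       \<bar>x - real p / real t ^ n\<bar> < \<psi> n}}"

end

theory Submission
  imports Defs "HOL-Library.Sublist"
begin

text \<open>
  Put \<open>N = card D\<close>, \<open>r\<^sub>n = \<psi> n - m / ((b - 1) b\<^sup>n)\<close> and
  \<open>h l = N\<^sup>l f (b\<^sup>-\<^sup>l)\<close>, which is monotonic in \<open>l\<close>. A point of the Cantor set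
  lies within \<open>\<psi> n\<close> of some \<open>p / b\<^sup>n\<close> only if it lies within \<open>r\<^sub>n\<close> of an end of its
  piece of generation \<open>n\<close>. Hence the points approximated at stage \<open>n\<close> are covered by
  \<open>2 N\<^sup>n\<close> sets of diameter at most \<open>r\<^sub>n\<close>, and a convergent sum gives measure 0.

  Conversely, let \<open>z\<close> be the extreme digit that realises \<open>m\<close>. A point is approximated at stage
  \<open>n\<close> as soon as its digits have a run of \<open>z\<close> of suitable length \<open>k n\<close> from position \<open>n\<close> on.
  If \<open>h\<close> tends to 0, the whole Cantor set is null. If \<open>h\<close> stays between two positive
  constants, counting words shows that the proportion of words without runs tends to 0, so the points
  with only finitely many runs form a null set. If \<open>h\<close> increases to infinity, every cover by
  cylinders of bounded cost misses a point with infinitely many runs: the point is built as the limit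
  of a nested sequence of cylinders, each of which ends with a run and is charged less than an eighth of
  its own cost by the cover. Hence the limsup set has infinite measure.
\<close>

section \<open>Hausdorff content and measure\<close>

lemma hf_cost_empty [simp]: "hf_cost f {} = 0"
  by (simp add: hf_cost_def)

lemma hausdorff_content_le:
  assumes "E \<subseteq> (\<Union>i. U i)" "\<And>i. bounded (U i) \<and> diameter (U i) \<le> \<delta>"
  shows "hausdorff_content f \<delta> E \<le> (\<Sum>i. hf_cost f (U i))"
  unfolding hausdorff_content_def using assms by (intro INF_lower) auto

lemma hausdorff_content_mono:
  assumes "E \<subseteq> F" shows "hausdorff_content f \<delta> E \<le> hausdorff_content f \<delta> F"
  unfolding hausdorff_content_def using assms by (intro INF_superset_mono) auto

lemma hausdorff_measure_mono:
  assumes "E \<subseteq> F" shows "hausdorff_measure f E \<le> hausdorff_measure f F"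
  unfolding hausdorff_measure_def using assms by (intro SUP_mono') (rule hausdorff_content_mono)

lemma hausdorff_content_single:
  assumes "bounded X" "diameter X \<le> \<delta>" "0 \<le> \<delta>"
  shows "hausdorff_content f \<delta> X \<le> hf_cost f X"
proof -
  let ?U = "\<lambda>i::nat. if i = 0 then X else {}"
  have "hausdorff_content f \<delta> X \<le> (\<Sum>i. hf_cost f (?U i))"
    by (rule hausdorff_content_le) (use assms in \<open>auto split: if_splits\<close>)
  also have "\<dots> = (\<Sum>i\<in>{0}. hf_cost f (?U i))"
    by (rule suminf_finite) auto
  finally show ?thesis by simp
qed

lemma hausdorff_content_empty [simp]: "0 \<le> \<delta> \<Longrightarrow> hausdorff_content f \<delta> {} = 0"
  using hausdorff_content_single[of "{}" \<delta> f] by simp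

text \<open>Covers of the \<open>E n\<close> that exceed the infimum by at most
  \<open>e / 2 ^ Suc n\<close> are merged into a single cover through \<open>prod_decode\<close>;
  together the excesses amount to \<open>e\<close>. An infinite right-hand side leaves nothing to
  prove.\<close>

lemma hausdorff_content_countable_subadditive:
  "hausdorff_content f \<delta> (\<Union>n::nat. E n) \<le> (\<Sum>n. hausdorff_content f \<delta> (E n))"
proof (cases "(\<Sum>n. hausdorff_content f \<delta> (E n)) = top")
  case False
  have fin: "hausdorff_content f \<delta> (E n) < top" for n
    using False ennreal_suminf_lessD[of "\<lambda>n. hausdorff_content f \<delta> (E n)" top] top.not_eq_extremum
    by blast
  show ?thesis
  proof (rule ennreal_le_epsilon)
    fix e :: real assume "0 < e"
    have "\<exists>U. (E n \<subseteq> (\<Union>i. U i) \<and> (\<forall>i::nat. bounded (U i) \<and> diameter (U i) \<le> \<delta>)) \<and>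
        (\<Sum>i. hf_cost f (U i)) < hausdorff_content f \<delta> (E n) + ennreal (e * (1/2) ^ Suc n)" for n
    proof -
      have "hausdorff_content f \<delta> (E n) < hausdorff_content f \<delta> (E n) + ennreal (e * (1/2) ^ Suc n)"
        using fin[of n] \<open>0 < e\<close> by (simp add: ennreal_zero_less_mult_iff)
      then show ?thesis
        unfolding hausdorff_content_def INF_less_iff by blast
    qed
    then obtain U where U: "\<And>n. E n \<subseteq> (\<Union>i. U n i)"
      "\<And>n i::nat. bounded (U n i) \<and> diameter (U n i) \<le> \<delta>"
      "\<And>n. (\<Sum>i. hf_cost f (U n i)) < hausdorff_content f \<delta> (E n) + ennreal (e * (1/2) ^ Suc n)"
      by metis
    let ?V = "\<lambda>j. case_prod U (prod_decode j)"
    have "(\<Union>n. E n) \<subseteq> (\<Union>j. ?V j)"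
    proof
      fix x assume "x \<in> (\<Union>n. E n)"
      then obtain n i where "x \<in> U n i" using U(1) by blast
      then show "x \<in> (\<Union>j. ?V j)"
        by (intro UN_I[of "prod_encode (n, i)"]) simp_all
    qed
    then have "hausdorff_content f \<delta> (\<Union>n. E n) \<le> (\<Sum>j. hf_cost f (?V j))"
      by (rule hausdorff_content_le) (use U(2) in \<open>auto split: prod.split\<close>)
    also have "\<dots> = (\<Sum>n. \<Sum>i. hf_cost f (U n i))"
      using suminf_ennreal_2dimen[of "\<lambda>n. \<Sum>i. hf_cost f (U n i)" "\<lambda>p. hf_cost f (case_prod U p)"]
      by (simp add: comp_def)
    also have "\<dots> \<le> (\<Sum>n. hausdorff_content f \<delta> (E n) + ennreal (e * (1/2) ^ Suc n))"
      by (intro suminf_le less_imp_le U(3)) auto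
    also have "\<dots> = (\<Sum>n. hausdorff_content f \<delta> (E n)) + (\<Sum>n. ennreal (e * (1/2) ^ Suc n))"
      by (simp add: suminf_add)
    also have "(\<Sum>n. ennreal (e * (1/2) ^ Suc n)) = ennreal e"
      using sums_mult[OF power_half_series, of e] \<open>0 < e\<close>
      by (intro suminf_ennreal_eq) auto
    finally show "hausdorff_content f \<delta> (\<Union>n. E n) \<le> (\<Sum>n. hausdorff_content f \<delta> (E n)) + ennreal e" .
  qed
qed simp

lemma hausdorff_content_Un:
  assumes "0 \<le> \<delta>"
  shows "hausdorff_content f \<delta> (E \<union> F) \<le> hausdorff_content f \<delta> E + hausdorff_content f \<delta> F"
proof -
  let ?E = "\<lambda>i::nat. if i = 0 then E else if i = 1 then F else {}"
  have "hausdorff_content f \<delta> (\<Union>i. ?E i) \<le> (\<Sum>i. hausdorff_content f \<delta> (?E i))"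
    by (rule hausdorff_content_countable_subadditive)
  also have "\<dots> = (\<Sum>i\<in>{0,1}. hausdorff_content f \<delta> (?E i))"
    by (rule suminf_finite) (use assms in auto)
  finally have "hausdorff_content f \<delta> (\<Union>i. ?E i) \<le> hausdorff_content f \<delta> E + hausdorff_content f \<delta> F"
    by simp
  moreover have "(\<Union>i. ?E i) = E \<union> F"
    by (auto split: if_splits)
  ultimately show ?thesis by simp
qed

lemma hausdorff_content_finite_cover:
  assumes "finite I" "0 \<le> \<delta>" "E \<subseteq> (\<Union>i\<in>I. X i)"
    and "\<And>i. i \<in> I \<Longrightarrow> bounded (X i) \<and> diameter (X i) \<le> \<delta> \<and> hf_cost f (X i) \<le> c"
  shows "hausdorff_content f \<delta> E \<le> of_nat (card I) * c"
proof -
  have "hausdorff_content f \<delta> (\<Union>i\<in>I. X i) \<le> of_nat (card I) * c"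
    using assms(1,4)
  proof induction
    case (insert j I)
    have "hausdorff_content f \<delta> (X j \<union> (\<Union>i\<in>I. X i)) \<le> hf_cost f (X j) + of_nat (card I) * c"
      using insert \<open>0 \<le> \<delta>\<close>
      by (intro order.trans[OF hausdorff_content_Un] add_mono hausdorff_content_single) auto
    also have "\<dots> \<le> c + of_nat (card I) * c"
      using insert by (intro add_mono) auto
    finally show ?case using insert by (simp add: algebra_simps)
  qed (use \<open>0 \<le> \<delta>\<close> in simp)
  then show ?thesis
    using hausdorff_content_mono[OF assms(3)] order.trans by blast
qed

lemma hausdorff_measure_zeroI:
  assumes "\<And>\<delta> e. 0 < \<delta> \<Longrightarrow> 0 < e \<Longrightarrow> hausdorff_content f \<delta> E \<le> ennreal e"
  shows "hausdorff_measure f E = 0"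
proof -
  have "hausdorff_content f \<delta> E = 0" if "0 < \<delta>" for \<delta>
  proof -
    have "hausdorff_content f \<delta> E \<le> 0"
      by (rule ennreal_le_epsilon) (use assms that in auto)
    then show ?thesis by simp
  qed
  then show ?thesis unfolding hausdorff_measure_def by simp
qed

lemma hausdorff_measure_Union_null:
  assumes "\<And>n::nat. hausdorff_measure f (E n) = 0"
  shows "hausdorff_measure f (\<Union>n. E n) = 0"
proof -
  have "hausdorff_content f \<delta> (\<Union>n. E n) = 0" if "0 < \<delta>" for \<delta>
  proof -
    have "hausdorff_content f \<delta> (E n) = 0" for n
    proof -
      have "hausdorff_content f \<delta> (E n) \<le> hausdorff_measure f (E n)"
        unfolding hausdorff_measure_def by (rule SUP_upper) (use that in simp)
      then show ?thesis using assms[of n] by simp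
    qed
    then show ?thesis
      using hausdorff_content_countable_subadditive[of f \<delta> E] by simp
  qed
  then show ?thesis unfolding hausdorff_measure_def by simp
qed

text \<open>A null set has content 0 at every scale, so by subadditivity removing it from
  \<open>E\<close> lowers no content.\<close>

lemma hausdorff_measure_Int_eq:
  assumes "hausdorff_measure f (E - F) = 0"
  shows "hausdorff_measure f (F \<inter> E) = hausdorff_measure f E"
proof (rule antisym)
  show "hausdorff_measure f E \<le> hausdorff_measure f (F \<inter> E)"
    unfolding hausdorff_measure_def
  proof (rule SUP_mono)
    fix \<delta> :: real assume d: "\<delta> \<in> {0<..}"
    have "hausdorff_content f \<delta> (E - F) \<le> hausdorff_measure f (E - F)"
      unfolding hausdorff_measure_def by (rule SUP_upper[OF d])
    then have "hausdorff_content f \<delta> (E - F) = 0" using assms by simp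
    moreover have "hausdorff_content f \<delta> ((F \<inter> E) \<union> (E - F))
        \<le> hausdorff_content f \<delta> (F \<inter> E) + hausdorff_content f \<delta> (E - F)"
      by (rule hausdorff_content_Un) (use d in simp)
    moreover have "(F \<inter> E) \<union> (E - F) = E" by blast
    ultimately show "\<exists>\<delta>'\<in>{0<..}. hausdorff_content f \<delta> E \<le> hausdorff_content f \<delta>' (F \<inter> E)"
      using d by auto
  qed
qed (auto intro: hausdorff_measure_mono)

section \<open>Words with runs of a fixed letter\<close>

lemma not_summable_unbounded:
  fixes y :: "nat \<Rightarrow> real"
  assumes "\<And>n. 0 \<le> y n" "\<not> summable y"
  obtains T where "n0 \<le> T" "B \<le> sum y {n0..<T}"
proof -
  have "\<exists>T. B + sum y {..<n0} < sum y {..<T}"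
  proof (rule ccontr)
    assume "\<not> ?thesis"
    then have "\<forall>T. sum y {..<T} \<le> B + sum y {..<n0}" by (simp add: not_less)
    then have "summable y"
      using assms(1) by (intro bounded_imp_summable[of y "B + sum y {..<n0}"])
        (simp_all only: lessThan_Suc_atMost[symmetric])
    with assms show False by simp
  qed
  then obtain T where T: "B + sum y {..<n0} < sum y {..<T}" by blast
  have "sum y {..<T} \<le> sum y ({..<n0} \<union> {n0..<T})"
    by (rule sum_mono2) (use assms in auto)
  also have "\<dots> = sum y {..<n0} + sum y {n0..<T}"
    by (rule sum.union_disjoint) auto
  finally have le: "B \<le> sum y {n0..<T}" using T by simp
  have "sum y {n0..<T} \<le> sum y {n0..<max n0 T}"
    by (rule sum_mono2) (use assms in auto)
  with le show ?thesis using that[of "max n0 T"] by simp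
qed

text \<open>Selects finitely many scales that carry a large part of a divergent cost \<open>y\<close> while
  their total measure \<open>x\<close> stays small.\<close>

lemma light_heavy_segment:
  fixes x y :: "nat \<Rightarrow> real"
  assumes x: "\<And>n. 0 \<le> x n" "\<And>n. x n \<le> 1/16"
    and y: "\<And>n. 0 \<le> y n" "\<not> summable y"
    and xy: "\<And>n. n0 \<le> n \<Longrightarrow> 16 * B * x n \<le> y n" and "0 \<le> B"
  obtains T where "sum x {n0..<T} \<le> 1/8" "B \<le> sum y {n0..<T}"
proof (cases "\<exists>T. 1/16 < sum x {n0..<T}")
  case True
  \<comment> \<open>Stopping at the first partial sum above 1/16 overshoots by at most one term, so
    the sum of \<open>x\<close> stays below 1/8, while \<open>xy\<close> turns the mass 1/16 into
    the cost \<open>B\<close>.\<close>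
  define T where "T = (LEAST T. 1/16 < sum x {n0..<T})"
  have T: "1/16 < sum x {n0..<T}" unfolding T_def using True by (rule LeastI_ex)
  have "n0 < T" using T by (cases "n0 < T") auto
  then obtain T' where T': "T = Suc T'" "n0 \<le> T'" by (cases T) auto
  have "\<not> 1/16 < sum x {n0..<T'}"
    using not_less_Least[of T' "\<lambda>T. 1/16 < sum x {n0..<T}"] T' by (simp add: T_def)
  then have "sum x {n0..<T} \<le> 1/8"
    using T' x(2)[of T'] by simp
  moreover have "B \<le> 16 * B * sum x {n0..<T}"
    using mult_left_mono[OF less_imp_le[OF T], of "16 * B"] \<open>0 \<le> B\<close> by simp
  then have "B \<le> sum y {n0..<T}"
    using sum_mono[of "{n0..<T}" "\<lambda>n. 16 * B * x n" y] xy by (simp add: sum_distrib_left)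
  ultimately show ?thesis by (rule that)
next
  case False
  obtain T where "B \<le> sum y {n0..<T}" using not_summable_unbounded[OF y] by blast
  moreover have "sum x {n0..<T} \<le> 1/16" using False by (simp add: not_less)
  ultimately show ?thesis using that[of T] by simp
qed

section \<open>Free words and their completion by a run\<close>

text \<open>\<open>A\<close> is the set of usable stages and \<open>k n\<close> the number of
  letters \<open>z\<close> demanded from position \<open>n\<close> on. Stages start at 1 to leave
  room for the letter before the run.\<close>

locale words =
  fixes D :: "'a set" and z :: 'a and A :: "nat set" and k :: "nat \<Rightarrow> nat"
  assumes finite_D: "finite D" and card_D: "2 \<le> card D" and z_in: "z \<in> D"
    and A_pos: "\<And>n. n \<in> A \<Longrightarrow> 1 \<le> n"
    and k_pos: "\<And>n. n \<in> A \<Longrightarrow> 1 \<le> k n"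
begin

abbreviation "N \<equiv> card D"

definition ext :: "nat \<Rightarrow> 'a list \<Rightarrow> 'a list set" where
  "ext n Q = {w. set w \<subseteq> D \<and> length w = n \<and> prefix Q w}"

text \<open>Demanding that the letter before the block differs from \<open>z\<close> is what makes the
  blocks found below pairwise disjoint; no independence of the events is needed.\<close>

definition run_in :: "'a list \<Rightarrow> nat \<Rightarrow> bool" where
  "run_in w n \<longleftrightarrow> n + k n \<le> length w \<and> w ! (n - 1) \<noteq> z \<and> (\<forall>j. n \<le> j \<and> j < n + k n \<longrightarrow> w ! j = z)"

text \<open>A first-hit condition: a run may start directly after \<open>P\<close>, and no stage of
  \<open>S\<close> has its complete run inside \<open>P\<close>.\<close>

definition free :: "nat set \<Rightarrow> 'a list \<Rightarrow> bool" where
  "free S P \<longleftrightarrow> P \<noteq> [] \<and> length P \<in> S \<and> set P \<subseteq> D \<and> P ! (length P - 1) \<noteq> z \<and> (\<forall>n\<in>S. \<not> run_in P n)"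

definition with_run :: "'a list \<Rightarrow> 'a list" where
  "with_run P = P @ replicate (k (length P)) z"

text \<open>The cylinder of \<open>u\<close> lies in that of \<open>P\<close> and meets that of
  \<open>with_run P\<close>. Words that break off within the run count too, as their cylinders
  contain the completed one.\<close>

definition near :: "'a list \<Rightarrow> 'a list \<Rightarrow> bool" where
  "near P u \<longleftrightarrow> prefix P u \<and> (prefix u (with_run P) \<or> prefix (with_run P) u)"

lemma length_with_run [simp]: "length (with_run P) = length P + k (length P)"
  by (simp add: with_run_def)

lemma prefix_with_run: "prefix P (with_run P)"
  by (simp add: with_run_def)

lemma set_with_run: "set P \<subseteq> D \<Longrightarrow> set (with_run P) \<subseteq> D"
  using z_in by (auto simp: with_run_def)

lemma prefix_nth: "prefix u v \<Longrightarrow> j < length u \<Longrightarrow> v ! j = u ! j"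
  by (auto simp: prefix_def nth_append)

lemma near_nth:
  assumes "near P u" "length P \<le> j" "j < length P + k (length P)" "j < length u"
  shows "u ! j = z"
proof -
  have "with_run P ! j = z" using assms by (simp add: with_run_def nth_append)
  moreover have "u ! j = with_run P ! j"
    using assms unfolding near_def by (metis length_with_run prefix_nth)
  ultimately show ?thesis by simp
qed

text \<open>A word \<open>u\<close> of a cover is charged to the free words \<open>P\<close> with \<open>near P u\<close>;
  there is at most one of them.\<close>

lemma near_unique_aux:
  assumes P: "free S P" "free S P'" "near P u" "near P' u" and lt: "length P < length P'"
  shows False
proof -
  let ?n = "length P" and ?n' = "length P'"
  have u: "u ! j = P' ! j" if "j < ?n'" for j
    using P(4) that by (simp add: near_def prefix_nth)
  have len: "?n' \<le> length u" using P(4) by (auto simp: near_def prefix_length_le)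
  have last: "P' ! (?n' - 1) \<noteq> z" using P(2) by (simp add: free_def)
  have u': "u ! j = P ! j" if "j < ?n" for j
    using P(3) that by (simp add: near_def prefix_nth)
  show False
  \<comment> \<open>Either the last letter of \<open>P'\<close> falls into the run after
    \<open>P\<close>, although it is not \<open>z\<close>, or that whole run lies inside
    \<open>P'\<close>, although \<open>P'\<close> is free.\<close>
  proof (cases "?n' - 1 < ?n + k ?n")
    case True
    then have "u ! (?n' - 1) = z" using near_nth[OF P(3), of "?n' - 1"] lt len by auto
    with u[of "?n' - 1"] last lt show False by simp
  next
    case False
    have "run_in P' ?n"
      unfolding run_in_def
    proof (intro conjI allI impI)
      show "?n + k ?n \<le> ?n'" using False by simp
      have "P' ! (?n - 1) = P ! (?n - 1)"
        using u[of "?n - 1"] u'[of "?n - 1"] lt P(1) by (simp add: free_def)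
      then show "P' ! (?n - 1) \<noteq> z" using P(1) by (simp add: free_def)
      show "P' ! j = z" if "?n \<le> j \<and> j < ?n + k ?n" for j
        using near_nth[OF P(3), of j] u[of j] that False len by auto
    qed
    then show False using P(1,2) by (auto simp: free_def)
  qed
qed

lemma near_unique:
  assumes "free S P" "free S P'" "near P u" "near P' u"
  shows "P = P'"
proof -
  have "length P = length P'"
    using near_unique_aux[of S P P' u] near_unique_aux[of S P' P u] assms by (metis nat_neq_iff)
  then show ?thesis
    using assms(3,4) unfolding near_def by (metis prefix_def append_eq_append_conv)
qed

section \<open>Counting words with prescribed letters\<close>

lemma finite_ext [simp]: "finite (ext n Q)"
  by (rule finite_subset[OF _ finite_lists_length_eq[OF finite_D, of n]]) (auto simp: ext_def)

lemma ext_eq_image: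
  assumes "set Q \<subseteq> D" "length Q \<le> n"
  shows "ext n Q = (@) Q ` {w. set w \<subseteq> D \<and> length w = n - length Q}"
proof (intro set_eqI iffI)
  fix w assume "w \<in> ext n Q"
  then obtain v where "w = Q @ v" "set v \<subseteq> D" "length Q + length v = n"
    by (auto simp: ext_def elim!: prefixE)
  then show "w \<in> (@) Q ` {w. set w \<subseteq> D \<and> length w = n - length Q}" by auto
next
  fix w assume "w \<in> (@) Q ` {w. set w \<subseteq> D \<and> length w = n - length Q}"
  then show "w \<in> ext n Q" using assms by (auto simp: ext_def)
qed

lemma card_ext:
  assumes "set Q \<subseteq> D" "length Q \<le> n"
  shows "card (ext n Q) = N ^ (n - length Q)"
proof -
  have "card (ext n Q) = card {w. set w \<subseteq> D \<and> length w = n - length Q}"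
    unfolding ext_eq_image[OF assms] by (rule card_image) (auto simp: inj_on_def)
  then show ?thesis by (simp add: card_lists_length_eq finite_D)
qed

lemma ext_empty: "\<not> set Q \<subseteq> D \<or> n < length Q \<Longrightarrow> ext n Q = {}"
  by (auto simp: ext_def prefix_def)

text \<open>Such a word is determined by its part before the block and its part after it, so the
  \<open>l\<close> fixed letters save a factor \<open>N ^ l\<close>.\<close>

lemma card_ext_block:
  assumes "set Q \<subseteq> D" "length Q \<le> m" "m + l \<le> n"
  shows "card {w \<in> ext n Q. \<forall>j. m \<le> j \<and> j < m + l \<longrightarrow> w ! j = z} \<le> N ^ (n - length Q - l)"
proof -
  let ?W = "{w \<in> ext n Q. \<forall>j. m \<le> j \<and> j < m + l \<longrightarrow> w ! j = z}"
  let ?V = "{v. set v \<subseteq> D \<and> length v = n - m - l}"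
  have fin: "finite ?V" by (rule finite_lists_length_eq[OF finite_D])
  have "?W \<subseteq> (\<lambda>(u, v). u @ replicate l z @ v) ` (ext m Q \<times> ?V)"
  proof
    fix w assume w: "w \<in> ?W"
    let ?u = "take m w" and ?v = "drop (m + l) w"
    have len: "length w = n" using w by (simp add: ext_def)
    have "take l (drop m w) = replicate l z"
      by (rule nth_equalityI) (use w len assms in auto)
    then have "w = ?u @ replicate l z @ ?v"
      by (metis append_take_drop_id drop_drop add.commute)
    moreover have "prefix Q ?u"
      using w assms len by (auto simp: ext_def prefix_def)
    then have "?u \<in> ext m Q" using w assms len set_take_subset[of m w] by (auto simp: ext_def)
    moreover have "?v \<in> ?V" using w assms len set_drop_subset[of "m + l" w] by (auto simp: ext_def)
    ultimately show "w \<in> (\<lambda>(u, v). u @ replicate l z @ v) ` (ext m Q \<times> ?V)"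
      by (intro image_eqI[of _ _ "(?u, ?v)"]) auto
  qed
  then have "card ?W \<le> card (ext m Q \<times> ?V)"
    by (rule surj_card_le[rotated]) (use fin in auto)
  also have "\<dots> = N ^ (m - length Q) * N ^ (n - m - l)"
    using assms by (simp add: card_cartesian_product card_ext card_lists_length_eq finite_D)
  also have "\<dots> = N ^ (n - length Q - l)"
    using assms by (simp flip: power_add)
  finally show ?thesis .
qed

text \<open>A union bound: an extension of \<open>Q\<close> that is not counted is bad (a proportion
  of at most 1/8), ends in \<open>z\<close> (at most 1/2), or contains the run of some stage in
  \<open>S\<close> (at most 1/8 by \<open>sm\<close>). A quarter remains.\<close>

lemma card_free_lower:
  assumes S: "finite S" "S \<subseteq> A" "\<And>n. n \<in> S \<Longrightarrow> length Q < n"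
    and sm: "(\<Sum>n\<in>S. 1 / real N ^ k n) \<le> 1/8"
    and Q: "set Q \<subseteq> D" and n: "n \<in> S"
    and bad: "real (card {P \<in> ext n Q. bad P}) \<le> real N ^ (n - length Q) / 8"
  shows "real N ^ (n - length Q) / 4 \<le> real (card {P \<in> ext n Q. free S P \<and> \<not> bad P})"
proof -
  let ?q = "length Q"
  \<comment> \<open>Only runs that end by position \<open>n\<close> can occur in a word of length
    \<open>n\<close>. This also keeps the exponent \<open>n - ?q - k n'\<close> from being truncated
    at 0.\<close>
  let ?R = "{n' \<in> S. n' + k n' \<le> n}"
  let ?block = "\<lambda>m l. {w \<in> ext n Q. \<forall>j. m \<le> j \<and> j < m + l \<longrightarrow> w ! j = z}"
  let ?F = "{P \<in> ext n Q. free S P \<and> \<not> bad P}" and ?B = "{P \<in> ext n Q. bad P}"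
  have N0: "real N > 0" using card_D by simp
  have q: "?q < n" using S n by blast
  have sub: "ext n Q \<subseteq> ?F \<union> ?B \<union> ?block (n - 1) 1 \<union> (\<Union>n'\<in>?R. ?block n' (k n'))"
  proof
    fix w assume w: "w \<in> ext n Q"
    then have len: "length w = n" by (simp add: ext_def)
    show "w \<in> ?F \<union> ?B \<union> ?block (n - 1) 1 \<union> (\<Union>n'\<in>?R. ?block n' (k n'))"
    proof (cases "bad w \<or> w ! (n - 1) = z")
      case True
      then show ?thesis
      proof
        assume "w ! (n - 1) = z"
        then have "w ! j = z" if "n - 1 \<le> j \<and> j < n - 1 + 1" for j
          using that q by (metis One_nat_def add.right_neutral add_Suc_right le_less_Suc_eq)
        then show ?thesis using w by blast
      qed (use w in blast)
    next
      case False
      show ?thesis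
      proof (cases "free S w")
        case True
        then show ?thesis using w False by blast
      next
        case nf: False
        then obtain n' where "n' \<in> S" "run_in w n'"
          using w n False len q by (auto simp: free_def ext_def)
        then have "n' \<in> ?R" "w \<in> ?block n' (k n')" using w len by (auto simp: run_in_def)
        then show ?thesis by blast
      qed
    qed
  qed
  have "card (ext n Q) \<le> card (?F \<union> ?B \<union> ?block (n - 1) 1 \<union> (\<Union>n'\<in>?R. ?block n' (k n')))"
    by (rule card_mono[OF _ sub]) (use S in auto)
  also have "\<dots> \<le> card ?F + card ?B + card (?block (n - 1) 1) + card (\<Union>n'\<in>?R. ?block n' (k n'))"
    by (meson add_mono card_Un_le le_trans order_refl)
  also have "\<dots> \<le> card ?F + card ?B + N ^ (n - ?q - 1) + (\<Sum>n'\<in>?R. N ^ (n - ?q - k n'))"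
  proof -
    have "card (?block (n - 1) 1) \<le> N ^ (n - ?q - 1)"
      by (rule card_ext_block) (use q Q in auto)
    moreover have "card (\<Union>n'\<in>?R. ?block n' (k n')) \<le> (\<Sum>n'\<in>?R. card (?block n' (k n')))"
      by (rule card_UN_le) (use S in auto)
    moreover have "\<dots> \<le> (\<Sum>n'\<in>?R. N ^ (n - ?q - k n'))"
    proof (rule sum_mono)
      fix n' assume n': "n' \<in> ?R"
      then have "?q \<le> n'" using S(3)[of n'] by simp
      then show "card (?block n' (k n')) \<le> N ^ (n - ?q - k n')"
        by (intro card_ext_block) (use n' Q in auto)
    qed
    ultimately show ?thesis by linarith
  qed
  finally have "real (card (ext n Q)) \<le> real (card ?F + card ?B + N ^ (n - ?q - 1) + (\<Sum>n'\<in>?R. N ^ (n - ?q - k n')))"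
    by (simp only: of_nat_le_iff)
  then have 1: "real N ^ (n - ?q) \<le> real (card ?F) + real (card ?B) + real N ^ (n - ?q - 1)
      + (\<Sum>n'\<in>?R. real N ^ (n - ?q - k n'))"
    using card_ext[OF Q, of n] q by simp
  have "2 * real N ^ (n - ?q - 1) \<le> real N * real N ^ (n - ?q - 1)"
    using card_D by (intro mult_right_mono) auto
  also have "\<dots> = real N ^ (n - ?q)" using q by (simp add: Suc_diff_Suc flip: power_Suc)
  finally have 2: "real N ^ (n - ?q - 1) \<le> real N ^ (n - ?q) / 2" by simp
  have "(\<Sum>n'\<in>?R. real N ^ (n - ?q - k n')) = (\<Sum>n'\<in>?R. real N ^ (n - ?q) * (1 / real N ^ k n'))"
  proof (rule sum.cong[OF refl])
    fix n' assume n': "n' \<in> ?R"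
    then have "k n' \<le> n - ?q" using S(3)[of n'] by auto
    then show "real N ^ (n - ?q - k n') = real N ^ (n - ?q) * (1 / real N ^ k n')"
      using N0 by (simp add: power_diff del: diff_diff_left)
  qed
  also have "\<dots> \<le> (\<Sum>n'\<in>S. real N ^ (n - ?q) * (1 / real N ^ k n'))"
    by (rule sum_mono2) (use S N0 in auto)
  also have "\<dots> = real N ^ (n - ?q) * (\<Sum>n'\<in>S. 1 / real N ^ k n')"
    by (simp only: sum_distrib_left)
  also have "\<dots> \<le> real N ^ (n - ?q) * (1/8)"
    using sm by (intro mult_left_mono) auto
  finally show ?thesis using 1 2 bad by simp
qed

section \<open>Covers by words and their cost\<close>

text \<open>What the cover \<open>w\<close> spends inside the cylinder of \<open>Q\<close>, if a
  word of length \<open>l\<close> costs \<open>\<phi> l\<close>.\<close>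

definition weight :: "(nat \<Rightarrow> real) \<Rightarrow> (nat \<Rightarrow> 'a list) \<Rightarrow> 'a list \<Rightarrow> ennreal" where
  "weight \<phi> w Q = (\<Sum>i. if prefix Q (w i) then ennreal (\<phi> (length (w i))) else 0)"

text \<open>Write \<open>q\<close> for the length of \<open>Q\<close>. A covering word of length
  \<open>l\<close> inside \<open>Q\<close> accounts for at most the proportion
  \<open>N ^ q / N ^ l\<close> of the extensions of \<open>Q\<close>, and by \<open>h\<close> this
  is at most \<open>\<phi> l / \<phi> q\<close>. Summed over the cover, the covered proportion is at
  most the weight divided by \<open>\<phi> q\<close>.\<close>

lemma card_covered:
  assumes Q: "set Q \<subseteq> D" "length Q \<le> n" and pos: "\<And>l. 0 < \<phi> l"
    and h: "\<And>l l'. l \<le> l' \<Longrightarrow> real N ^ l * \<phi> l \<le> real N ^ l' * \<phi> l'"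
    and weight: "weight \<phi> w Q < ennreal (\<phi> (length Q) / 8)"
  shows "real (card {P \<in> ext n Q. \<exists>i. prefix Q (w i) \<and> prefix (w i) P}) \<le> real N ^ (n - length Q) / 8"
proof -
  let ?q = "length Q"
  let ?B = "{P \<in> ext n Q. \<exists>i. prefix Q (w i) \<and> prefix (w i) P}"
  define C where "C = real N ^ (n - ?q) / \<phi> ?q"
  have N0: "real N > 0" using card_D by simp
  have C0: "0 \<le> C" using pos[of ?q] by (simp add: C_def)
  have "of_nat (card ?B) = (\<Sum>P\<in>?B. 1 :: ennreal)" by simp
  also have "\<dots> \<le> (\<Sum>P\<in>?B. \<Sum>i. if prefix Q (w i) \<and> prefix (w i) P then 1 else 0)"
  proof (rule sum_mono)
    fix P assume "P \<in> ?B"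
    then obtain i where i: "prefix Q (w i) \<and> prefix (w i) P" by blast
    have "(\<Sum>i\<in>{i}. if prefix Q (w i) \<and> prefix (w i) P then 1 else 0 :: ennreal)
        \<le> (\<Sum>i. if prefix Q (w i) \<and> prefix (w i) P then 1 else 0)"
      by (rule sum_le_suminf) auto
    then show "1 \<le> (\<Sum>i. if prefix Q (w i) \<and> prefix (w i) P then 1 else 0 :: ennreal)"
      using i by simp
  qed
  also have "\<dots> = (\<Sum>i. \<Sum>P\<in>?B. if prefix Q (w i) \<and> prefix (w i) P then 1 else 0)"
    by (rule suminf_sum[symmetric]) auto
  also have "\<dots> \<le> (\<Sum>i. ennreal C * (if prefix Q (w i) then ennreal (\<phi> (length (w i))) else 0))"
  proof (rule suminf_le)
    fix i
    show "(\<Sum>P\<in>?B. if prefix Q (w i) \<and> prefix (w i) P then 1 else 0)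
        \<le> ennreal C * (if prefix Q (w i) then ennreal (\<phi> (length (w i))) else 0)"
    proof (cases "prefix Q (w i)")
      case True
      let ?l = "length (w i)"
      have ql: "?q \<le> ?l" using True by (rule prefix_length_le)
      have "real (card (ext n (w i))) \<le> C * \<phi> ?l"
      proof (cases "set (w i) \<subseteq> D \<and> ?l \<le> n")
        case True
        have "real N ^ (n - ?l) * \<phi> ?q * real N ^ ?l = real N ^ n * \<phi> ?q"
          using True by (simp add: mult.commute mult.left_commute flip: power_add)
        also have "\<dots> = real N ^ (n - ?q) * (real N ^ ?q * \<phi> ?q)"
          using Q by (simp flip: power_add mult.assoc)
        also have "\<dots> \<le> real N ^ (n - ?q) * (real N ^ ?l * \<phi> ?l)"
          using h[OF ql] by (intro mult_left_mono) auto
        finally have "real N ^ (n - ?l) * \<phi> ?q * real N ^ ?l \<le> (real N ^ (n - ?q) * \<phi> ?l) * real N ^ ?l"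
          by (simp add: mult_ac)
        then have "real N ^ (n - ?l) * \<phi> ?q \<le> real N ^ (n - ?q) * \<phi> ?l"
          using N0 by simp
        then show ?thesis using True pos[of ?q] by (simp add: card_ext C_def field_simps)
      next
        case False
        then have "ext n (w i) = {}" by (intro ext_empty) auto
        then show ?thesis using C0 pos[of ?l] by simp
      qed
      then have "ennreal (real (card (ext n (w i)))) \<le> ennreal (C * \<phi> ?l)"
        by (rule ennreal_leI)
      moreover have "(\<Sum>P\<in>?B. if prefix Q (w i) \<and> prefix (w i) P then 1 else 0 :: ennreal)
          \<le> of_nat (card (ext n (w i)))"
      proof -
        have "(\<Sum>P\<in>?B. if prefix Q (w i) \<and> prefix (w i) P then 1 else 0 :: ennreal)
            = of_nat (card {P \<in> ?B. prefix Q (w i) \<and> prefix (w i) P})"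
          by (simp add: sum.If_cases Int_def)
        also have "\<dots> \<le> of_nat (card (ext n (w i)))"
          by (intro of_nat_mono card_mono finite_ext) (auto simp: ext_def)
        finally show ?thesis .
      qed
      ultimately show ?thesis
        using True C0 pos[of ?l] by (simp add: ennreal_of_nat_eq_real_of_nat ennreal_mult)
    qed simp
  qed auto
  also have "\<dots> = ennreal C * weight \<phi> w Q"
    unfolding weight_def by (rule ennreal_suminf_cmult)
  also have "\<dots> \<le> ennreal C * ennreal (\<phi> ?q / 8)"
    using weight by (intro mult_left_mono) auto
  also have "\<dots> = ennreal (real N ^ (n - ?q) / 8)"
    using C0 pos[of ?q] by (simp add: C_def flip: ennreal_mult)
  finally show ?thesis
    by (simp add: ennreal_of_nat_eq_real_of_nat)
qed

text \<open>A good word still leaves room: no covering word contains its cylinder, and the covering words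
  inside the cylinder are too cheap to cover it.\<close>

definition good :: "(nat \<Rightarrow> real) \<Rightarrow> (nat \<Rightarrow> 'a list) \<Rightarrow> 'a list \<Rightarrow> bool" where
  "good \<phi> w Q \<longleftrightarrow> set Q \<subseteq> D \<and> (\<forall>i. \<not> prefix (w i) Q) \<and> weight \<phi> w Q < ennreal (\<phi> (length Q) / 8)"

text \<open>By \<open>near_unique\<close> at most one summand can differ from 0: no part of the
  cover is charged twice.\<close>

lemma sum_near_le:
  assumes "finite I" "\<And>P. P \<in> I \<Longrightarrow> free S P"
  shows "(\<Sum>P\<in>I. if near P u then c else 0) \<le> (c :: ennreal)"
proof (cases "\<exists>P\<in>I. near P u")
  case True
  then obtain P where P: "P \<in> I" "near P u" by blast
  have "(\<Sum>P'\<in>I. if near P' u then c else 0) = (\<Sum>P'\<in>I. if P' = P then c else 0)"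
  proof (rule sum.cong[OF refl])
    fix P' assume P': "P' \<in> I"
    have "near P' u \<longleftrightarrow> P' = P"
      using near_unique[OF assms(2)[OF P'] assms(2)[OF P(1)] _ P(2)] P(2) by metis
    then show "(if near P' u then c else 0) = (if P' = P then c else 0)" by simp
  qed
  also have "\<dots> = c" using P assms(1) by (simp add: sum.delta)
  finally show ?thesis by simp
next
  case False
  then have "(\<Sum>P\<in>I. if near P u then c else 0) = (\<Sum>P\<in>I. 0)"
    by (intro sum.cong) auto
  then show ?thesis by simp
qed

text \<open>\<open>with_run P\<close> can fail in two ways. If a covering word is a prefix of it,
  that word must extend \<open>P\<close>, and by \<open>anti\<close> it alone is expensive enough.
  Otherwise the covering words that extend \<open>with_run P\<close> cost at least an eighth. All
  these words are near \<open>P\<close>.\<close>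

lemma not_good_with_run:
  assumes pos: "\<And>l. 0 < \<phi> l" and anti: "\<And>l l'. l \<le> l' \<Longrightarrow> \<phi> l' \<le> \<phi> l"
    and Q: "\<And>i. \<not> prefix (w i) Q"
    and P: "set P \<subseteq> D" "prefix Q P" "\<not> (\<exists>i. prefix Q (w i) \<and> prefix (w i) P)"
    and ng: "\<not> good \<phi> w (with_run P)"
  shows "ennreal (\<phi> (length (with_run P)) / 8) \<le>
    (\<Sum>i. if prefix Q (w i) \<and> near P (w i) then ennreal (\<phi> (length (w i))) else 0)"
proof (cases "\<exists>i. prefix (w i) (with_run P)")
  case True
  then obtain i where i: "prefix (w i) (with_run P)" by blast
  have "prefix Q (with_run P)" using P(2) prefix_with_run prefix_order.trans by blast
  then have Qi: "prefix Q (w i)" using i Q prefix_same_cases by blast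
  then have "\<not> prefix (w i) P" using P(3) by blast
  then have "prefix P (w i)" using i prefix_with_run prefix_same_cases by blast
  then have n: "near P (w i)" using i by (simp add: near_def)
  have "\<phi> (length (with_run P)) \<le> \<phi> (length (w i))" by (rule anti[OF prefix_length_le[OF i]])
  then have "\<phi> (length (with_run P)) / 8 \<le> \<phi> (length (w i))" using pos[of "length (with_run P)"] by simp
  then have "ennreal (\<phi> (length (with_run P)) / 8) \<le>
      (\<Sum>i\<in>{i}. if prefix Q (w i) \<and> near P (w i) then ennreal (\<phi> (length (w i))) else 0)"
    using Qi n by (simp add: ennreal_leI)
  also have "\<dots> \<le> (\<Sum>i. if prefix Q (w i) \<and> near P (w i) then ennreal (\<phi> (length (w i))) else 0)"
    by (rule sum_le_suminf) auto
  finally show ?thesis .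
next
  case False
  then have "ennreal (\<phi> (length (with_run P)) / 8) \<le> weight \<phi> w (with_run P)"
    using ng set_with_run[OF P(1)] by (auto simp: good_def)
  also have "\<dots> \<le> (\<Sum>i. if prefix Q (w i) \<and> near P (w i) then ennreal (\<phi> (length (w i))) else 0)"
    unfolding weight_def
  proof (rule suminf_le)
    fix i
    have "prefix Q (w i) \<and> near P (w i)" if "prefix (with_run P) (w i)"
      using that P(2) prefix_with_run[of P] unfolding near_def by (meson prefix_order.trans)
    then show "(if prefix (with_run P) (w i) then ennreal (\<phi> (length (w i))) else 0)
       \<le> (if prefix Q (w i) \<and> near P (w i) then ennreal (\<phi> (length (w i))) else 0)"
      by simp
  qed auto
  finally show ?thesis .
qed

text \<open>If every run completing a free word inside \<open>Q\<close> were bad, then each of them would absorb an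
  eighth of its own cost from the cover. These absorbed parts are disjoint, and a quarter of all words
  of each selected length is free, so the cover would be too expensive on \<open>Q\<close>.\<close>

lemma good_step:
  assumes pos: "\<And>l. 0 < \<phi> l" and anti: "\<And>l l'. l \<le> l' \<Longrightarrow> \<phi> l' \<le> \<phi> l"
    and h: "\<And>l l'. l \<le> l' \<Longrightarrow> real N ^ l * \<phi> l \<le> real N ^ l' * \<phi> l'"
    and unbdd: "\<And>B. \<exists>l. B \<le> real N ^ l * \<phi> l"
    and k4: "\<And>n. n \<in> A \<Longrightarrow> 4 \<le> k n"
    and div: "\<not> summable (\<lambda>n. if n \<in> A then real N ^ n * \<phi> (n + k n) else 0)"
    and good: "good \<phi> w Q"
  shows "\<exists>P. length Q < length P \<and> length P \<in> A \<and> prefix Q P \<and> P ! (length P - 1) \<noteq> z \<and> good \<phi> w (with_run P)"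
proof (rule ccontr)
  assume contra: "\<not> ?thesis"
  let ?q = "length Q"
  define x where "x = (\<lambda>n. if n \<in> A then 1 / real N ^ k n else 0)"
  define y where "y = (\<lambda>n. if n \<in> A then real N ^ n * \<phi> (n + k n) else 0)"
  \<comment> \<open>The factor 4 makes up for only a quarter of the words being free: in the end
    \<open>B / (4 * N ^ ?q)\<close> equals \<open>\<phi> ?q\<close>, which the cover cannot
    afford.\<close>
  define B where "B = 4 * (real N ^ ?q * \<phi> ?q)"
  have N0: "real N > 0" using card_D by simp
  have B0: "0 \<le> B" using pos[of ?q] by (simp add: B_def)
  \<comment> \<open>Unboundedness makes \<open>y n\<close> at least \<open>16 * B * x n\<close> from
    some scale on. Starting beyond \<open>?q\<close> makes the selected words proper extensions of
    \<open>Q\<close>.\<close>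
  obtain l where l: "16 * B \<le> real N ^ l * \<phi> l" using unbdd by blast
  define n0 where "n0 = max l (Suc ?q)"
  have n0: "16 * B \<le> real N ^ n0 * \<phi> n0" using l h[of l n0] by (simp add: n0_def)
  obtain T where T: "sum x {n0..<T} \<le> 1/8" "B \<le> sum y {n0..<T}"
  proof (rule light_heavy_segment[of x y n0 B])
    show "0 \<le> x n" for n by (simp add: x_def)
    show "x n \<le> 1/16" for n
    proof (cases "n \<in> A")
      case True
      \<comment> \<open>Runs of length at least 4 over at least two letters give
        \<open>x n \<le> 1/16\<close>.\<close>
      have "(2::real) ^ 4 \<le> 2 ^ k n" using k4[OF True] by (rule power_increasing) simp
      also have "\<dots> \<le> real N ^ k n" using card_D by (intro power_mono) auto
      finally have "16 \<le> real N ^ k n" by simp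
      then show ?thesis using True card_D by (simp add: x_def divide_le_eq)
    qed (simp add: x_def)
    show "0 \<le> y n" for n using pos[of "n + k n"] by (simp add: y_def)
    show "\<not> summable y" using div by (simp add: y_def)
    show "16 * B * x n \<le> y n" if "n0 \<le> n" for n
    proof (cases "n \<in> A")
      case True
      have "16 * B \<le> real N ^ (n + k n) * \<phi> (n + k n)"
        using n0 h[of n0 "n + k n"] that by simp
      then have "16 * B / real N ^ k n \<le> real N ^ n * \<phi> (n + k n)"
        using N0 by (simp add: field_simps power_add)
      then show ?thesis using True by (simp add: x_def y_def)
    qed (simp add: x_def y_def)
  qed (use B0 in auto)
  define S where "S = A \<inter> {n0..<T}"
  have S: "finite S" "S \<subseteq> A" "\<And>n. n \<in> S \<Longrightarrow> ?q < n" by (auto simp: S_def n0_def)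
  have Sx: "(\<Sum>n\<in>S. 1 / real N ^ k n) \<le> 1/8"
    using T(1) by (simp add: x_def S_def Int_commute flip: sum.inter_restrict)
  have Sy: "B \<le> (\<Sum>n\<in>S. real N ^ n * \<phi> (n + k n))"
    using T(2) by (simp add: y_def S_def Int_commute flip: sum.inter_restrict)
  define bad where "bad = (\<lambda>P. \<exists>i. prefix Q (w i) \<and> prefix (w i) P)"
  define J where "J = (\<lambda>n. {P \<in> ext n Q. free S P \<and> \<not> bad P})"
  define I where "I = (\<Union>n\<in>S. J n)"
  have finJ: "finite (J n)" for n by (simp add: J_def)
  then have finI: "finite I" using S by (simp add: I_def)
  have freeI: "free S P" if "P \<in> I" for P using that by (auto simp: I_def J_def)
  have Qg: "set Q \<subseteq> D" "\<And>i. \<not> prefix (w i) Q" "weight \<phi> w Q < ennreal (\<phi> ?q / 8)"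
    using good by (auto simp: good_def)
  have cardJ: "real N ^ (n - ?q) / 4 \<le> real (card (J n))" if "n \<in> S" for n
    unfolding J_def
  proof (rule card_free_lower[OF S Sx Qg(1) that])
    show "real (card {P \<in> ext n Q. bad P}) \<le> real N ^ (n - ?q) / 8"
      unfolding bad_def by (rule card_covered[OF Qg(1) less_imp_le[OF S(3)[OF that]] pos h Qg(3)])
  qed
  have "ennreal (\<Sum>P\<in>I. \<phi> (length (with_run P)) / 8) = (\<Sum>P\<in>I. ennreal (\<phi> (length (with_run P)) / 8))"
    using pos by (intro sum_ennreal[symmetric]) (simp add: less_imp_le)
  also have "\<dots> \<le> (\<Sum>P\<in>I. \<Sum>i. if prefix Q (w i) \<and> near P (w i) then ennreal (\<phi> (length (w i))) else 0)"
  proof (rule sum_mono)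
    fix P assume P: "P \<in> I"
    then obtain n where n: "n \<in> S" "P \<in> J n" by (auto simp: I_def)
    then have "set P \<subseteq> D" "prefix Q P" "\<not> bad P" "length P = n" "P ! (length P - 1) \<noteq> z"
      by (auto simp: J_def ext_def free_def)
    moreover from this have "\<not> good \<phi> w (with_run P)"
      using contra n S(2,3) by blast
    ultimately show "ennreal (\<phi> (length (with_run P)) / 8)
        \<le> (\<Sum>i. if prefix Q (w i) \<and> near P (w i) then ennreal (\<phi> (length (w i))) else 0)"
      using Qg(2) pos anti by (intro not_good_with_run) (auto simp: bad_def)
  qed
  also have "\<dots> = (\<Sum>i. \<Sum>P\<in>I. if prefix Q (w i) \<and> near P (w i) then ennreal (\<phi> (length (w i))) else 0)"
    by (rule suminf_sum[symmetric]) auto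
  also have "\<dots> \<le> weight \<phi> w Q"
    unfolding weight_def
  proof (rule suminf_le)
    show "(\<Sum>P\<in>I. if prefix Q (w i) \<and> near P (w i) then ennreal (\<phi> (length (w i))) else 0)
        \<le> (if prefix Q (w i) then ennreal (\<phi> (length (w i))) else 0)" for i
      using sum_near_le[of I S "w i" "ennreal (\<phi> (length (w i)))", OF finI freeI] by simp
  qed auto
  also have "\<dots> < ennreal (\<phi> ?q / 8)" by (rule Qg(3))
  finally have "(\<Sum>P\<in>I. \<phi> (length (with_run P)) / 8) < \<phi> ?q / 8"
    using pos by (subst (asm) ennreal_less_iff) (auto intro!: sum_nonneg simp: less_imp_le)
  then have lt: "(\<Sum>P\<in>I. \<phi> (length (with_run P))) < \<phi> ?q"
    by (simp flip: sum_divide_distrib)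
  \<comment> \<open>The same sum sorted by length: \<open>cardJ\<close> and \<open>Sy\<close> bound
    it below by \<open>\<phi> ?q\<close>, against \<open>lt\<close>.\<close>
  have "(\<Sum>P\<in>I. \<phi> (length (with_run P))) = (\<Sum>n\<in>S. \<Sum>P\<in>J n. \<phi> (length (with_run P)))"
    unfolding I_def by (rule sum.UNION_disjoint) (use S finJ in \<open>auto simp: J_def ext_def\<close>)
  also have "\<dots> = (\<Sum>n\<in>S. real (card (J n)) * \<phi> (n + k n))"
  proof (rule sum.cong[OF refl])
    fix n
    have "(\<Sum>P\<in>J n. \<phi> (length (with_run P))) = (\<Sum>P\<in>J n. \<phi> (n + k n))"
      by (rule sum.cong[OF refl]) (auto simp: J_def ext_def)
    then show "(\<Sum>P\<in>J n. \<phi> (length (with_run P))) = real (card (J n)) * \<phi> (n + k n)" by simp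
  qed
  also have "\<dots> \<ge> (\<Sum>n\<in>S. real N ^ (n - ?q) / 4 * \<phi> (n + k n))"
    by (intro sum_mono mult_right_mono cardJ) (use pos less_imp_le in blast)+
  also have "(\<Sum>n\<in>S. real N ^ (n - ?q) / 4 * \<phi> (n + k n))
      = (\<Sum>n\<in>S. 1 / (4 * real N ^ ?q) * (real N ^ n * \<phi> (n + k n)))"
  proof (rule sum.cong[OF refl])
    fix n assume "n \<in> S"
    then show "real N ^ (n - ?q) / 4 * \<phi> (n + k n) = 1 / (4 * real N ^ ?q) * (real N ^ n * \<phi> (n + k n))"
      using S(3)[of n] N0 by (simp add: power_diff)
  qed
  also have "\<dots> = 1 / (4 * real N ^ ?q) * (\<Sum>n\<in>S. real N ^ n * \<phi> (n + k n))"
    by (simp only: sum_distrib_left)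
  also have "\<dots> \<ge> 1 / (4 * real N ^ ?q) * B"
    using Sy by (intro mult_left_mono) auto
  also have "1 / (4 * real N ^ ?q) * B = \<phi> ?q" using N0 by (simp add: B_def)
  finally show False using lt by simp
qed

section \<open>Infinite words with infinitely many runs\<close>

definition run :: "(nat \<Rightarrow> 'a) \<Rightarrow> nat \<Rightarrow> bool" where
  "run s n \<longleftrightarrow> s (n - 1) \<noteq> z \<and> (\<forall>j. n \<le> j \<and> j < n + k n \<longrightarrow> s j = z)"

lemma prefix_chain_limit:
  assumes pre: "\<And>i. prefix (Qs i) (Qs (Suc i))" and len: "\<And>i. i \<le> length (Qs i)"
  obtains s where "\<And>i j. j < length (Qs i) \<Longrightarrow> s j = Qs i ! j"
proof
  fix i j assume j: "j < length (Qs i)"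
  have mono: "prefix (Qs i) (Qs i')" if "i \<le> i'" for i i'
    using that by (induction rule: dec_induct) (auto intro: prefix_order.trans pre)
  have j': "j < length (Qs (Suc j))" using len[of "Suc j"] by simp
  \<comment> \<open>The limit is \<open>\<lambda>j. Qs (Suc j) ! j\<close>: the word with index
    \<open>Suc j\<close> is sure to have more than \<open>j\<close> letters.\<close>
  show "Qs (Suc j) ! j = Qs i ! j"
    using mono[of "Suc j" i] mono[of i "Suc j"] prefix_nth[of "Qs (Suc j)" "Qs i" j, OF _ j']
      prefix_nth[of "Qs i" "Qs (Suc j)" j, OF _ j] by (metis nat_le_linear)
qed

text \<open>Iterating \<open>good_step\<close> yields nested good words, each ending in the run of a
  later stage. No \<open>w i\<close> begins the limit, for it would then be a prefix of a
  sufficiently long good word.\<close>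

lemma good_limit:
  assumes pos: "\<And>l. 0 < \<phi> l" and anti: "\<And>l l'. l \<le> l' \<Longrightarrow> \<phi> l' \<le> \<phi> l"
    and h: "\<And>l l'. l \<le> l' \<Longrightarrow> real N ^ l * \<phi> l \<le> real N ^ l' * \<phi> l'"
    and unbdd: "\<And>B. \<exists>l. B \<le> real N ^ l * \<phi> l"
    and k4: "\<And>n. n \<in> A \<Longrightarrow> 4 \<le> k n"
    and div: "\<not> summable (\<lambda>n. if n \<in> A then real N ^ n * \<phi> (n + k n) else 0)"
    and good: "good \<phi> w Q"
  obtains s where "\<And>j. s j \<in> D" "infinite {n \<in> A. run s n}" "\<And>i. map s [0..<length (w i)] \<noteq> w i"
proof -
  let ?R = "\<lambda>Q Q'. \<exists>P. length Q < length P \<and> length P \<in> A \<and> prefix Q P \<and> P ! (length P - 1) \<noteq> z \<and> Q' = with_run P"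
  obtain Qs where Qs: "\<And>i. good \<phi> w (Qs i)" "\<And>i. ?R (Qs i) (Qs (Suc i))"
  proof (rule dependent_nat_choice[of "\<lambda>_. good \<phi> w" "\<lambda>_. ?R", THEN exE])
    show "\<exists>Q. good \<phi> w Q" using good by blast
    show "\<exists>Q'. good \<phi> w Q' \<and> ?R Q Q'" if "good \<phi> w Q" for Q and n :: nat
      using good_step[OF pos anti h unbdd k4 div that] by blast
  qed blast
  obtain P where P: "\<And>i. length (Qs i) < length (P i)" "\<And>i. length (P i) \<in> A" "\<And>i. prefix (Qs i) (P i)"
    "\<And>i. P i ! (length (P i) - 1) \<noteq> z" "\<And>i. Qs (Suc i) = with_run (P i)"
    using Qs(2) by metis
  have pre: "prefix (Qs i) (Qs (Suc i))" for i
    using P(3)[of i] prefix_with_run[of "P i"] unfolding P(5) by (rule prefix_order.trans)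
  have len: "i \<le> length (Qs i)" for i
  proof (induction i)
    case (Suc i)
    then show ?case using P(1)[of i] by (simp add: P(5))
  qed simp
  obtain s where s: "\<And>i j. j < length (Qs i) \<Longrightarrow> s j = Qs i ! j"
    using prefix_chain_limit[OF pre len] by metis
  have "s j \<in> D" for j
  proof -
    have j: "j < length (Qs (Suc j))" using len[of "Suc j"] by simp
    have "set (Qs (Suc j)) \<subseteq> D" using Qs(1) by (simp add: good_def)
    then show ?thesis unfolding s[OF j] using nth_mem[OF j] by blast
  qed
  moreover have "run s (length (P i))" for i
    unfolding run_def
  proof (intro conjI allI impI)
    have ne: "0 < length (P i)" using P(1)[of i] by linarith
    have "s (length (P i) - 1) = Qs (Suc i) ! (length (P i) - 1)"
      by (rule s) (use ne in \<open>simp add: P(5) less_diff_conv2 trans_less_add1\<close>)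
    then show "s (length (P i) - 1) \<noteq> z" using P(4)[of i] ne by (simp add: P(5) with_run_def nth_append)
    show "s j = z" if "length (P i) \<le> j \<and> j < length (P i) + k (length (P i))" for j
      using s[of j "Suc i"] that by (simp add: P(5) with_run_def nth_append less_diff_conv2)
  qed
  then have "infinite {n \<in> A. run s n}"
    unfolding infinite_nat_iff_unbounded_le using P(1,2) len
    by (metis (mono_tags, lifting) mem_Collect_eq order.strict_implies_order order.trans)
  moreover have "map s [0..<length (w i)] \<noteq> w i" for i
  proof
    assume eq: "map s [0..<length (w i)] = w i"
    let ?Q = "Qs (length (w i))"
    have "w i = take (length (w i)) ?Q"
    proof (rule nth_equalityI)
      fix j assume "j < length (w i)"
      then show "w i ! j = take (length (w i)) ?Q ! j"
        using s[of j "length (w i)"] len[of "length (w i)"] eq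
        by (metis add_0 diff_zero length_upt nth_map nth_take nth_upt order_less_le_trans)
    qed (use len[of "length (w i)"] in simp)
    then have "prefix (w i) ?Q" by (metis take_is_prefix)
    then show False using Qs(1) by (auto simp: good_def)
  qed
  ultimately show ?thesis by (rule that)
qed

text \<open>Each covering word extends at most one word of length \<open>l\<close>, so the weights
  of these \<open>N ^ l\<close> words sum up to at most the total cost. Hence one of them has weight
  below \<open>\<phi> l / 8\<close>; as all covering words are longer than \<open>l\<close>, it is
  good.\<close>

lemma avoid_cover_infinite_runs:
  assumes pos: "\<And>l. 0 < \<phi> l" and anti: "\<And>l l'. l \<le> l' \<Longrightarrow> \<phi> l' \<le> \<phi> l"
    and h: "\<And>l l'. l \<le> l' \<Longrightarrow> real N ^ l * \<phi> l \<le> real N ^ l' * \<phi> l'"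
    and unbdd: "\<And>B. \<exists>l. B \<le> real N ^ l * \<phi> l"
    and k4: "\<And>n. n \<in> A \<Longrightarrow> 4 \<le> k n"
    and div: "\<not> summable (\<lambda>n. if n \<in> A then real N ^ n * \<phi> (n + k n) else 0)"
    and len: "\<And>i. l < length (w i)"
    and total: "(\<Sum>i. ennreal (\<phi> (length (w i)))) < ennreal (real N ^ l * \<phi> l / 8)"
  obtains s where "\<And>j. s j \<in> D" "infinite {n \<in> A. run s n}" "\<And>i. map s [0..<length (w i)] \<noteq> w i"
proof -
  have "\<exists>Q\<in>ext l []. weight \<phi> w Q < ennreal (\<phi> l / 8)"
  proof (rule ccontr)
    assume "\<not> ?thesis"
    then have "ennreal (\<phi> l / 8) \<le> weight \<phi> w Q" if "Q \<in> ext l []" for Q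
      using that by (simp add: not_less)
    then have "(\<Sum>Q\<in>ext l []. ennreal (\<phi> l / 8)) \<le> (\<Sum>Q\<in>ext l []. weight \<phi> w Q)"
      by (rule sum_mono)
    also have "\<dots> = (\<Sum>i. \<Sum>Q\<in>ext l []. if prefix Q (w i) then ennreal (\<phi> (length (w i))) else 0)"
      unfolding weight_def by (rule suminf_sum[symmetric]) auto
    also have "\<dots> \<le> (\<Sum>i. ennreal (\<phi> (length (w i))))"
    proof (rule suminf_le)
      fix i
      have "(\<Sum>Q\<in>ext l []. if prefix Q (w i) then ennreal (\<phi> (length (w i))) else 0)
          \<le> (\<Sum>Q\<in>ext l []. if Q = take l (w i) then ennreal (\<phi> (length (w i))) else 0)"
        by (rule sum_mono) (auto simp: ext_def prefix_def)
      also have "\<dots> \<le> ennreal (\<phi> (length (w i)))"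
        by (simp add: sum.delta)
      finally show "(\<Sum>Q\<in>ext l []. if prefix Q (w i) then ennreal (\<phi> (length (w i))) else 0)
          \<le> ennreal (\<phi> (length (w i)))" .
    qed auto
    also have "\<dots> < ennreal (real N ^ l * \<phi> l / 8)" by (rule total)
    also have "\<dots> = (\<Sum>Q\<in>ext l []. ennreal (\<phi> l / 8))"
      using pos[of l] by (simp add: card_ext ennreal_of_nat_eq_real_of_nat flip: ennreal_mult)
    finally show False by simp
  qed
  then obtain Q where Q: "Q \<in> ext l []" "weight \<phi> w Q < ennreal (\<phi> l / 8)" by blast
  moreover have "\<not> prefix (w i) Q" for i
    using len[of i] Q(1) prefix_length_le[of "w i" Q] by (auto simp: ext_def)
  ultimately have "good \<phi> w Q"
    by (auto simp: good_def ext_def)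
  from good_limit[OF pos anti h unbdd k4 div this] that show ?thesis by metis
qed

section \<open>Finite words without late runs\<close>

definition avoid :: "nat \<Rightarrow> nat \<Rightarrow> 'a list set" where
  "avoid M n = {w \<in> ext n []. \<forall>n'\<in>A. M \<le> n' \<longrightarrow> \<not> run_in w n'}"

lemma finite_avoid [simp]: "finite (avoid M n)"
  by (simp add: avoid_def)

text \<open>Appending a letter other than \<open>z\<close> to an avoiding word gives a free word: a
  run that is new in the longer word would have to end with the appended letter.\<close>

lemma card_free_ge_avoid:
  assumes S: "S \<subseteq> A \<inter> {M..}" and n: "Suc n \<in> S"
  shows "card (avoid M n) * (N - 1) \<le> card {P \<in> ext (Suc n) []. free S P}"
proof -
  let ?g = "\<lambda>(w, d). w @ [d]"
  have "?g ` (avoid M n \<times> (D - {z})) \<subseteq> {P \<in> ext (Suc n) []. free S P}"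
  proof safe
    fix w d assume w: "w \<in> avoid M n" and d: "d \<in> D" "d \<noteq> z"
    have len: "length w = n" and wD: "set w \<subseteq> D" using w by (auto simp: avoid_def ext_def)
    then show "w @ [d] \<in> ext (Suc n) []" using d by (auto simp: ext_def)
    have "\<not> run_in (w @ [d]) n'" if n': "n' \<in> S" for n'
    proof
      assume r: "run_in (w @ [d]) n'"
      have A: "n' \<in> A" "M \<le> n'" using n' S by auto
      have k1: "1 \<le> k n'" "1 \<le> n'" using A k_pos A_pos by auto
      show False
      proof (cases "n' + k n' \<le> n")
        case True
        have "run_in w n'" unfolding run_in_def
        proof (intro conjI allI impI)
          show "n' + k n' \<le> length w" using True len by simp
          show "w ! (n' - 1) \<noteq> z" using r True len k1 by (auto simp: run_in_def nth_append split: if_splits)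
          show "w ! j = z" if "n' \<le> j \<and> j < n' + k n'" for j
          proof -
            have "(w @ [d]) ! j = z" using r that by (auto simp: run_in_def)
            then show ?thesis using that True len by (simp add: nth_append)
          qed
        qed
        then show False using w A by (auto simp: avoid_def)
      next
        case False
        then have "(w @ [d]) ! n = z" using r len k1 by (auto simp: run_in_def)
        then show False using d len by (simp add: nth_append)
      qed
    qed
    then show "free S (w @ [d])" using n len wD d by (auto simp: free_def nth_append)
  qed
  then have "card (?g ` (avoid M n \<times> (D - {z}))) \<le> card {P \<in> ext (Suc n) []. free S P}"
    by (rule card_mono[rotated]) simp
  moreover have "card (?g ` (avoid M n \<times> (D - {z}))) = card (avoid M n) * (N - 1)"
    using z_in finite_D by (subst card_image) (auto simp: inj_on_def card_cartesian_product)
  ultimately show ?thesis by simp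
qed

text \<open>\<open>1 / N ^ (n + k n)\<close> is the uniform measure of the cylinder of
  \<open>with_run P\<close> for \<open>P\<close> of length \<open>n\<close>, and these cylinders are
  disjoint by \<open>near_unique\<close>. Measures are compared by counting extensions of one common
  length \<open>L\<close>.\<close>

lemma sum_free_le:
  assumes S: "finite S"
  shows "(\<Sum>n\<in>S. real (card {P \<in> ext n []. free S P}) / real N ^ (n + k n)) \<le> 1"
proof -
  define L where "L = (\<Sum>n\<in>S. n + k n)"
  have L: "n + k n \<le> L" if "n \<in> S" for n
    unfolding L_def using S that by (intro member_le_sum) auto
  have N0: "real N > 0" using card_D by simp
  let ?J = "\<lambda>n. {P \<in> ext n []. free S P}"
  define I where "I = (\<Union>n\<in>S. ?J n)"
  have I: "P \<in> I \<longleftrightarrow> free S P" for P by (auto simp: I_def ext_def free_def)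
  have finI: "finite I" using S by (simp add: I_def)
  have "(\<Sum>P\<in>I. card (ext L (with_run P))) = card (\<Union>P\<in>I. ext L (with_run P))"
  proof (rule card_UN_disjoint[symmetric])
    show "\<forall>P\<in>I. \<forall>P'\<in>I. P \<noteq> P' \<longrightarrow> ext L (with_run P) \<inter> ext L (with_run P') = {}"
    proof (intro ballI impI)
      fix P P' assume P: "P \<in> I" "P' \<in> I" "P \<noteq> P'"
      have "near P u" if "u \<in> ext L (with_run P)" for u P
        using that prefix_with_run[of P] prefix_order.trans by (auto simp: near_def ext_def)
      then show "ext L (with_run P) \<inter> ext L (with_run P') = {}"
        using P near_unique[of S P P'] I by (meson disjoint_iff)
    qed
  qed (use finI in auto)
  also have "\<dots> \<le> card (ext L [])"
    by (intro card_mono finite_ext) (auto simp: ext_def)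
  also have "\<dots> = N ^ L" by (simp add: card_ext)
  finally have le: "real (\<Sum>P\<in>I. card (ext L (with_run P))) \<le> real N ^ L"
    by (metis of_nat_le_iff of_nat_power)
  have "(\<Sum>P\<in>I. card (ext L (with_run P))) = (\<Sum>n\<in>S. \<Sum>P\<in>?J n. card (ext L (with_run P)))"
    unfolding I_def
  proof (rule sum.UNION_disjoint)
    show "\<forall>n\<in>S. \<forall>n'\<in>S. n \<noteq> n' \<longrightarrow> ?J n \<inter> ?J n' = {}" by (auto simp: ext_def)
  qed (use S in auto)
  also have "\<dots> = (\<Sum>n\<in>S. \<Sum>P\<in>?J n. N ^ (L - (n + k n)))"
  proof (intro sum.cong refl)
    fix n P assume "n \<in> S" "P \<in> ?J n"
    then show "card (ext L (with_run P)) = N ^ (L - (n + k n))"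
      using L[of n] set_with_run[of P] by (subst card_ext) (auto simp: ext_def)
  qed
  finally have "(\<Sum>n\<in>S. real (card (?J n)) * real N ^ (L - (n + k n))) \<le> real N ^ L"
    using le by simp
  moreover have "(\<Sum>n\<in>S. real (card (?J n)) * real N ^ (L - (n + k n)))
      = real N ^ L * (\<Sum>n\<in>S. real (card (?J n)) / real N ^ (n + k n))"
    unfolding sum_distrib_left using L N0 by (intro sum.cong refl) (simp add: power_diff)
  ultimately show ?thesis using N0 by simp
qed

text \<open>The cylinders that complete free words are disjoint, so their measures sum up to at most 1. If the
  proportion of avoiding words stayed above \<open>e\<close>, this sum would dominate a divergent series.\<close>

lemma avoid_small:
  assumes div: "\<not> summable (\<lambda>n. if n \<in> A then 1 / real N ^ k n else 0)" and "0 < e"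
  shows "\<exists>n\<ge>n1. real (card (avoid M n)) \<le> e * real N ^ n"
proof (rule ccontr)
  assume "\<not> ?thesis"
  then have big: "e * real N ^ n < real (card (avoid M n))" if "n1 \<le> n" for n
    using that by (meson not_le)
  \<comment> \<open>A free word of length \<open>n\<close> comes from an avoiding word of length
    \<open>n - 1\<close>, and \<open>big\<close> needs \<open>n1 \<le> n - 1\<close>.\<close>
  define M' where "M' = max M (Suc n1)"
  define x where "x = (\<lambda>n. if n \<in> A then 1 / real N ^ k n else 0)"
  have N0: "real N > 0" using card_D by simp
  \<comment> \<open>After the factor \<open>e / 2\<close> this leaves 2, more than the 1 that
    \<open>sum_free_le\<close> allows.\<close>
  obtain T where T: "2 * 2 / e \<le> sum x {M'..<T}"
  proof (rule not_summable_unbounded[of x M' "2 * 2 / e"])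
    show "0 \<le> x n" for n by (simp add: x_def)
    show "\<not> summable x" using div by (simp add: x_def)
  qed
  define S where "S = A \<inter> {M'..<T}"
  have S: "finite S" "S \<subseteq> A \<inter> {M..}" by (auto simp: S_def M'_def)
  have "e / 2 * (1 / real N ^ k n) \<le> real (card {P \<in> ext n []. free S P}) / real N ^ (n + k n)"
    if "n \<in> S" for n
  proof -
    have "Suc n1 \<le> n" using that by (simp add: S_def M'_def)
    then obtain n' where n': "n = Suc n'" "n1 \<le> n'" by (cases n) auto
    have "real N / 2 \<le> real (N - 1)" using card_D by linarith
    then have "e * real N ^ n' * (real N / 2) \<le> real (card (avoid M n')) * real (N - 1)"
      using big[OF n'(2)] \<open>0 < e\<close> by (intro mult_mono) auto
    also have "\<dots> \<le> real (card {P \<in> ext n []. free S P})"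
      using card_free_ge_avoid[OF S(2), of n'] that n' by (metis of_nat_le_iff of_nat_mult)
    finally have "e / 2 * real N ^ n \<le> real (card {P \<in> ext n []. free S P})"
      by (simp add: n' mult_ac)
    then show ?thesis using N0 by (simp add: field_simps power_add)
  qed
  then have "(\<Sum>n\<in>S. e / 2 * (1 / real N ^ k n)) \<le> 1"
    by (rule order.trans[OF sum_mono sum_free_le[OF S(1)]])
  then have "e / 2 * (\<Sum>n\<in>S. 1 / real N ^ k n) \<le> 1" by (simp only: sum_distrib_left)
  moreover have "(\<Sum>n\<in>S. 1 / real N ^ k n) = sum x {M'..<T}"
    by (simp add: x_def S_def Int_commute flip: sum.inter_restrict)
  moreover have "e / 2 * (2 * 2 / e) \<le> e / 2 * sum x {M'..<T}"
    using T \<open>0 < e\<close> by (intro mult_left_mono) auto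
  ultimately show False using \<open>0 < e\<close> by simp
qed

lemma run_run_in:
  assumes "n + k n \<le> L" "1 \<le> n" "1 \<le> k n" "run_in (map s [0..<L]) n"
  shows "run s n"
  unfolding run_def
proof (intro conjI allI impI)
  have "map s [0..<L] ! (n - 1) \<noteq> z" using assms(4) by (simp add: run_in_def)
  then show "s (n - 1) \<noteq> z" using assms(1-3) by simp
  fix j assume j: "n \<le> j \<and> j < n + k n"
  then have "map s [0..<L] ! j = z" using assms(4) unfolding run_in_def by blast
  then show "s j = z" using assms(1) j by simp
qed

lemma map_in_avoid:
  assumes "\<And>j. s j \<in> D" "\<And>n. n \<in> A \<Longrightarrow> M \<le> n \<Longrightarrow> \<not> run s n"
  shows "map s [0..<L] \<in> avoid M L"
proof -
  have "\<not> run_in (map s [0..<L]) n" if "n \<in> A" "M \<le> n" for n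
  proof
    assume r: "run_in (map s [0..<L]) n"
    then have "n + k n \<le> L" by (simp add: run_in_def)
    from run_run_in[OF this A_pos k_pos r] that assms(2) show False by blast
  qed
  then show ?thesis using assms(1) by (auto simp: avoid_def ext_def)
qed

end

section \<open>Expansions in base b\<close>

definition expansion :: "nat \<Rightarrow> (nat \<Rightarrow> nat) \<Rightarrow> real" where
  "expansion b s = (\<Sum>n. real (s n) / real b ^ Suc n)"

text \<open>The integer with base \<open>b\<close> digits \<open>s 0, ..., s (n - 1)\<close>, that
  is, the numerator over \<open>b ^ n\<close> of the truncated expansion.\<close>

primrec head :: "nat \<Rightarrow> (nat \<Rightarrow> nat) \<Rightarrow> nat \<Rightarrow> nat" where
  "head b s 0 = 0"
| "head b s (Suc n) = b * head b s n + s n"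

lemma cantor_set_eq: "cantor_set b D = expansion b ` {s. \<forall>n. s n \<in> D}"
  by (auto simp: cantor_set_def expansion_def)

lemma summable_expansion:
  assumes "2 \<le> b" "\<And>n. s n < b"
  shows "summable (\<lambda>n. real (s n) / real b ^ Suc n)"
proof (rule summable_comparison_test')
  show "summable (\<lambda>n. (1 / real b) ^ n)"
    using assms(1) by (intro summable_geometric) simp
  fix n :: nat
  have "real (s n) / real b ^ Suc n \<le> real b / real b ^ Suc n"
    using assms(2)[of n] by (intro divide_right_mono) auto
  also have "\<dots> = (1 / real b) ^ n" using assms(1) by (simp add: power_divide)
  finally show "norm (real (s n) / real b ^ Suc n) \<le> (1 / real b) ^ n" by simp
qed

lemma expansion_const:
  assumes "2 \<le> b"
  shows "expansion b (\<lambda>_. d) = real d / (real b - 1)"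
proof -
  have "(\<lambda>n. real d / real b * (1 / real b) ^ n) sums (real d / real b * (1 / (1 - 1 / real b)))"
    using assms by (intro sums_mult geometric_sums) simp
  moreover have "real d / real b * (1 / (1 - 1 / real b)) = real d / (real b - 1)"
    using assms by (simp add: field_simps)
  moreover have "(\<lambda>n. real d / real b * (1 / real b) ^ n) = (\<lambda>n. real d / real b ^ Suc n)"
    by (simp add: power_divide)
  ultimately show ?thesis unfolding expansion_def by (simp add: sums_iff)
qed

lemma expansion_mono:
  assumes "2 \<le> b" "\<And>n. t n < b" "\<And>n. s n \<le> t n"
  shows "expansion b s \<le> expansion b t"
  unfolding expansion_def
proof (rule suminf_le)
  have "s n < b" for n using assms(2,3)[of n] by simp
  then show "summable (\<lambda>n. real (s n) / real b ^ Suc n)" by (rule summable_expansion[OF assms(1)])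
  show "summable (\<lambda>n. real (t n) / real b ^ Suc n)" by (rule summable_expansion[OF assms(1,2)])
  show "real (s n) / real b ^ Suc n \<le> real (t n) / real b ^ Suc n" for n
    using assms(3)[of n] by (intro divide_right_mono) auto
qed

lemma expansion_bounds:
  assumes "2 \<le> b" "\<And>n. lo \<le> s n" "\<And>n. s n \<le> hi" "hi < b"
  shows "real lo / (real b - 1) \<le> expansion b s" "expansion b s \<le> real hi / (real b - 1)"
proof -
  have s: "s n < b" for n using assms(3)[of n] assms(4) by simp
  show "real lo / (real b - 1) \<le> expansion b s"
    unfolding expansion_const[OF assms(1), symmetric]
    by (rule expansion_mono[OF assms(1) s assms(2)])
  show "expansion b s \<le> real hi / (real b - 1)"
    unfolding expansion_const[OF assms(1), symmetric]
    by (rule expansion_mono[OF assms(1,4,3)])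
qed

lemma expansion_unit:
  assumes "2 \<le> b" "\<And>n. s n < b"
  shows "0 \<le> expansion b s" "expansion b s \<le> 1"
proof -
  have "s n \<le> b - 1" for n using assms(2)[of n] by simp
  then show "0 \<le> expansion b s" "expansion b s \<le> 1"
    using expansion_bounds[of b 0 s "b - 1"] assms by auto
qed

text \<open>One digit at a time moves from the tail into the head. This is the self-similarity
  behind all distance estimates: a piece of generation \<open>n\<close> is a translated copy scaled
  by \<open>1 / b ^ n\<close>.\<close>

lemma expansion_shift:
  assumes "2 \<le> b" "\<And>n. s n < b"
  shows "expansion b s = (real (head b s n) + expansion b (\<lambda>j. s (n + j))) / real b ^ n"
proof (induction n)
  case (Suc n)
  let ?t = "\<lambda>j. s (n + j)"
  have sm: "summable (\<lambda>j. real (?t j) / real b ^ Suc j)"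
    by (rule summable_expansion) (use assms in auto)
  have sm': "summable (\<lambda>j. real (s (Suc n + j)) / real b ^ Suc j)"
    by (rule summable_expansion) (use assms in auto)
  have "expansion b ?t = real (s n) / real b + (\<Sum>j. real (?t (Suc j)) / real b ^ Suc (Suc j))"
    using suminf_split_head[OF sm] unfolding expansion_def by simp
  also have "(\<Sum>j. real (?t (Suc j)) / real b ^ Suc (Suc j))
      = (\<Sum>j. (real (s (Suc n + j)) / real b ^ Suc j) / real b)"
    by (simp add: mult_ac)
  also have "\<dots> = expansion b (\<lambda>j. s (Suc n + j)) / real b"
    unfolding expansion_def by (rule suminf_divide[OF sm'])
  finally have "expansion b ?t = (real (s n) + expansion b (\<lambda>j. s (Suc n + j))) / real b"
    by (simp add: add_divide_distrib)
  moreover have "(x + (y + w) / real b) / real b ^ n = (real b * x + y + w) / real b ^ Suc n" for x y w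
    using assms(1) by (simp add: field_simps)
  ultimately show ?case unfolding Suc.IH by simp
qed simp

lemma head_cong: "(\<And>j. j < n \<Longrightarrow> s j = t j) \<Longrightarrow> head b s n = head b t n"
  by (induction n) auto

text \<open>Division by \<open>b\<close> with remainder recovers the last digit and the previous
  head.\<close>

lemma head_inj:
  assumes "head b s n = head b t n" "\<And>j. s j < b" "\<And>j. t j < b"
  shows "map s [0..<n] = map t [0..<n]"
  using assms(1)
proof (induction n)
  case (Suc n)
  have "head b s n = (b * head b s n + s n) div b" "s n = (b * head b s n + s n) mod b"
    using assms(2)[of n] by auto
  moreover have "head b t n = (b * head b t n + t n) div b" "t n = (b * head b t n + t n) mod b"
    using assms(3)[of n] by auto
  ultimately show ?case using Suc by simp
qed simp

text \<open>Compared with the constant sequence \<open>d\<close>, the heads agree, and the tails,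
  which lie in the unit interval, are scaled by \<open>1 / b ^ k\<close>.\<close>

lemma expansion_run:
  assumes "2 \<le> b" "\<And>n. s n < b" "d < b" "\<And>j. j < k \<Longrightarrow> s j = d"
  shows "\<bar>expansion b s - real d / (real b - 1)\<bar> \<le> 1 / real b ^ k"
proof -
  let ?H = "real (head b (\<lambda>_. d) k)"
  have "expansion b s - expansion b (\<lambda>_. d)
      = (?H + expansion b (\<lambda>j. s (k + j))) / real b ^ k - (?H + expansion b (\<lambda>_. d)) / real b ^ k"
    using expansion_shift[of b s k, OF assms(1,2)] expansion_shift[of b "\<lambda>_. d" k, OF assms(1)]
      head_cong[of k s "\<lambda>_. d" b] assms(3,4) by simp
  also have "\<dots> = (expansion b (\<lambda>j. s (k + j)) - expansion b (\<lambda>_. d)) / real b ^ k"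
    by (simp flip: diff_divide_distrib)
  finally have "expansion b s - expansion b (\<lambda>_. d)
      = (expansion b (\<lambda>j. s (k + j)) - expansion b (\<lambda>_. d)) / real b ^ k" .
  moreover have "\<bar>expansion b (\<lambda>j. s (k + j)) - expansion b (\<lambda>_. d)\<bar> \<le> 1"
    using expansion_unit[OF assms(1), of "\<lambda>j. s (k + j)"] expansion_unit[OF assms(1), of "\<lambda>_. d"] assms(2,3)
    by (simp add: abs_le_iff)
  ultimately show ?thesis
    using assms(1) by (simp add: expansion_const abs_divide divide_right_mono)
qed

lemma expansion_same_prefix:
  assumes "2 \<le> b" "\<And>n. s n < b" "\<And>n. t n < b" "map s [0..<n] = map t [0..<n]"
  shows "\<bar>expansion b s - expansion b t\<bar> = \<bar>expansion b (\<lambda>j. s (n + j)) - expansion b (\<lambda>j. t (n + j))\<bar> / real b ^ n"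
proof -
  have "head b s n = head b t n"
    by (rule head_cong) (use assms(4) in simp)
  then show ?thesis
    using expansion_shift[of b s n, OF assms(1,2)] expansion_shift[of b t n, OF assms(1,3)]
    by (simp add: diff_divide_distrib[symmetric] abs_divide)
qed

text \<open>Tails lie in the unit interval, so points less than \<open>1 / b ^ l\<close> apart have
  heads that differ by at most 1. Above the least head \<open>a\<close> occurring in
  \<open>U\<close> only \<open>a + 1\<close> is left, and a head determines its word.\<close>

lemma small_set_two_prefixes:
  assumes b: "2 \<le> b" and D: "D \<subseteq> {..<b}"
    and U: "\<And>x y. x \<in> U \<Longrightarrow> y \<in> U \<Longrightarrow> \<bar>x - y\<bar> < 1 / real b ^ l"
  shows "\<exists>u v. length u = l \<and> length v = l \<and>
    (\<forall>s. (\<forall>n. s n \<in> D) \<longrightarrow> expansion b s \<in> U \<longrightarrow> map s [0..<l] = u \<or> map s [0..<l] = v)"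
proof -
  let ?T = "{s. (\<forall>n. s n \<in> D) \<and> expansion b s \<in> U}"
  have Db: "s n < b" if "s \<in> ?T" for s n using that D by auto
  show ?thesis
  proof (cases "?T = {}")
    case True
    then show ?thesis by (intro exI[of _ "replicate l 0"]) auto
  next
    case False
    define a where "a = (LEAST a. \<exists>s\<in>?T. head b s l = a)"
    have "\<exists>a. \<exists>s\<in>?T. head b s l = a" using False by blast
    then have "\<exists>s\<in>?T. head b s l = a" unfolding a_def by (rule LeastI_ex)
    then obtain s0 where s0: "s0 \<in> ?T" "head b s0 l = a" by blast
    have two: "head b s l = a \<or> head b s l = a + 1" if s: "s \<in> ?T" for s
    proof -
      have "a \<le> head b s l" unfolding a_def using s by (intro Least_le) blast
      have P: "0 < real b ^ l" using b by simp
      have "expansion b s = (real (head b s l) + expansion b (\<lambda>j. s (l + j))) / real b ^ l"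
        by (rule expansion_shift[OF b Db[OF s]])
      moreover have "expansion b s0 = (real a + expansion b (\<lambda>j. s0 (l + j))) / real b ^ l"
        using expansion_shift[of b s0 l, OF b Db[OF s0(1)]] s0(2) by simp
      moreover have "expansion b s - expansion b s0 < 1 / real b ^ l"
        using U[of "expansion b s" "expansion b s0"] s s0(1) by auto
      ultimately have "((real (head b s l) + expansion b (\<lambda>j. s (l + j))) - (real a + expansion b (\<lambda>j. s0 (l + j)))) / real b ^ l < 1 / real b ^ l"
        by (simp add: diff_divide_distrib)
      then have "(real (head b s l) + expansion b (\<lambda>j. s (l + j))) - (real a + expansion b (\<lambda>j. s0 (l + j))) < 1"
        using P by (simp only: divide_less_cancel)
      moreover have "0 \<le> expansion b (\<lambda>j. s (l + j))" "expansion b (\<lambda>j. s0 (l + j)) \<le> 1"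
        by (rule expansion_unit; use b Db[OF s] Db[OF s0(1)] in auto)+
      ultimately have "real (head b s l) < real a + 2" by simp
      then show ?thesis using \<open>a \<le> head b s l\<close> by linarith
    qed
    show ?thesis
    proof (cases "\<exists>s1\<in>?T. head b s1 l = a + 1")
      case True
      then obtain s1 where s1: "s1 \<in> ?T" "head b s1 l = a + 1" by blast
      have "map s [0..<l] = map s0 [0..<l] \<or> map s [0..<l] = map s1 [0..<l]" if "s \<in> ?T" for s
        using two[OF that]
      proof
        assume "head b s l = a"
        then have "map s [0..<l] = map s0 [0..<l]"
          using Db that s0 by (intro head_inj[of b s l s0]) auto
        then show ?thesis ..
      next
        assume "head b s l = a + 1"
        then have "map s [0..<l] = map s1 [0..<l]"
          using Db that s1 by (intro head_inj[of b s l s1]) auto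
        then show ?thesis ..
      qed
      then show ?thesis by (intro exI[of _ "map s0 [0..<l]"] exI[of _ "map s1 [0..<l]"]) auto
    next
      case False
      have "map s [0..<l] = map s0 [0..<l]" if "s \<in> ?T" for s
      proof (rule head_inj)
        have "head b s l \<noteq> a + 1" using False that by blast
        then show "head b s l = head b s0 l" using two[OF that] s0(2) by simp
        show "s j < b" for j by (rule Db[OF that])
        show "s0 j < b" for j by (rule Db[OF s0(1)])
      qed
      then show ?thesis by (intro exI[of _ "map s0 [0..<l]"]) auto
    qed
  qed
qed

section \<open>Hausdorff measure of sets of expansions\<close>

lemma hf_cost_le:
  assumes "mono_on {0<..} f" "0 < r" "diameter X \<le> r" "bounded X"
  shows "hf_cost f X \<le> ennreal (f r)"
proof (cases "diameter X = 0")
  case False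
  then have "0 < diameter X" using diameter_ge_0[OF assms(4)] by simp
  then have "f (diameter X) \<le> f r"
    using assms(1-3) by (intro mono_onD[OF assms(1)]) auto
  then show ?thesis using False by (simp add: hf_cost_def ennreal_leI)
qed (simp add: hf_cost_def)

locale coded_cantor_set =
  fixes b :: nat and D :: "nat set" and f :: "real \<Rightarrow> real"
  assumes b_ge: "2 \<le> b" and D_sub: "D \<subseteq> {..<b}" and D_card: "2 \<le> card D"
    and f_pos: "\<And>r. 0 < r \<Longrightarrow> 0 < f r" and f_mono: "mono_on {0<..} f"
    and f_lim: "(f \<longlongrightarrow> 0) (at_right 0)"
begin

text \<open>The price of a cylinder of generation \<open>l\<close>; \<open>h l\<close> below is the
  price of all \<open>card D ^ l\<close> of them together.\<close>

definition \<phi> :: "nat \<Rightarrow> real" where "\<phi> l = f (1 / real b ^ l)"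
definition h :: "nat \<Rightarrow> real" where "h l = real (card D) ^ l * \<phi> l"

lemma D_finite: "finite D"
  using D_sub finite_subset by blast

lemma digit_less: "\<forall>n. s n \<in> D \<Longrightarrow> s n < b" for s :: "nat \<Rightarrow> nat"
  using D_sub by auto

lemma expansion_unit_D:
  assumes "\<forall>n. s n \<in> D"
  shows "0 \<le> expansion b s" "expansion b s \<le> 1"
  using expansion_unit[of b s, OF b_ge digit_less[OF assms]] by simp_all

lemma b_pos [simp]: "0 < b"
  using b_ge by simp

lemma phi_pos: "0 < \<phi> l"
  unfolding \<phi>_def by (rule f_pos) simp

lemma h_pos: "0 < h l"
  using phi_pos D_card unfolding h_def by simp

lemma f_le: "0 < x \<Longrightarrow> x \<le> y \<Longrightarrow> f x \<le> f y"
  by (rule mono_onD[OF f_mono]) auto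

lemma scale_mono: "l \<le> l' \<Longrightarrow> 1 / real b ^ l' \<le> 1 / real b ^ l"
  using b_ge by (intro divide_left_mono power_increasing) auto

lemma phi_anti: "l \<le> l' \<Longrightarrow> \<phi> l' \<le> \<phi> l"
  unfolding \<phi>_def by (rule f_le[OF _ scale_mono]) auto

lemma scale_tendsto: "(\<lambda>l. 1 / real b ^ l) \<longlonglongrightarrow> 0"
  using LIMSEQ_power_zero[of "1 / real b"] b_ge by (simp add: power_divide)

lemma scale_eventually: "0 < \<delta> \<Longrightarrow> \<exists>M. \<forall>l\<ge>M. 1 / real b ^ l < \<delta>"
  using order_tendstoD(2)[OF scale_tendsto] by (simp add: eventually_sequentially)

lemma phi_tendsto: "\<phi> \<longlonglongrightarrow> 0"
proof -
  have "filterlim (\<lambda>l. 1 / real b ^ l) (at_right 0) sequentially"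
    unfolding filterlim_at using scale_tendsto by auto
  from filterlim_compose[OF f_lim this] show ?thesis by (simp add: \<phi>_def[abs_def])
qed

lemma content_le_words:
  assumes V: "finite V" and E: "E \<subseteq> expansion b ` {s. (\<forall>j. s j \<in> D) \<and> map s [0..<n] \<in> V}"
    and d: "1 / real b ^ n \<le> \<delta>"
  shows "hausdorff_content f \<delta> E \<le> of_nat (card V) * ennreal (\<phi> n)"
proof (rule hausdorff_content_finite_cover[OF V])
  let ?X = "\<lambda>w. expansion b ` {s. (\<forall>j. s j \<in> D) \<and> map s [0..<n] = w}"
  show "0 \<le> \<delta>" using d by (rule order.trans[rotated]) simp
  show "E \<subseteq> (\<Union>w\<in>V. ?X w)" using E by blast
  fix w assume "w \<in> V"
  have "?X w \<subseteq> {0..1}" using expansion_unit_D by auto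
  then have bd: "bounded (?X w)" by (rule bounded_subset[rotated]) simp
  have diam: "diameter (?X w) \<le> 1 / real b ^ n"
  proof (rule diameter_le)
    fix x y assume "x \<in> ?X w" "y \<in> ?X w"
    then obtain s t where st: "\<forall>j. s j \<in> D" "\<forall>j. t j \<in> D" "map s [0..<n] = w" "map t [0..<n] = w"
      "x = expansion b s" "y = expansion b t" by blast
    then have "\<bar>x - y\<bar> = \<bar>expansion b (\<lambda>j. s (n + j)) - expansion b (\<lambda>j. t (n + j))\<bar> / real b ^ n"
      using digit_less[of s] digit_less[of t] by (simp add: expansion_same_prefix[OF b_ge])
    also have "\<dots> \<le> 1 / real b ^ n"
      using expansion_unit_D[of "\<lambda>j. s (n + j)"] expansion_unit_D[of "\<lambda>j. t (n + j)"] st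
      by (intro divide_right_mono) (auto simp: abs_le_iff)
    finally show "norm (x - y) \<le> 1 / real b ^ n" by simp
  qed simp
  have "hf_cost f (?X w) \<le> ennreal (\<phi> n)"
    unfolding \<phi>_def by (rule hf_cost_le[OF f_mono _ diam bd]) simp
  then show "bounded (?X w) \<and> diameter (?X w) \<le> \<delta> \<and> hf_cost f (?X w) \<le> ennreal (\<phi> n)"
    using bd diam d by auto
qed

text \<open>The cover by all cylinders of generation \<open>n\<close> costs at most
  \<open>h n\<close>.\<close>

lemma measure_cantor_zero:
  assumes "\<And>e M. 0 < e \<Longrightarrow> \<exists>n\<ge>M. h n \<le> e"
  shows "hausdorff_measure f (cantor_set b D) = 0"
proof (rule hausdorff_measure_zeroI)
  fix \<delta> e :: real assume "0 < \<delta>" "0 < e"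
  obtain M where M: "\<forall>l\<ge>M. 1 / real b ^ l < \<delta>" using scale_eventually[OF \<open>0 < \<delta>\<close>] by blast
  obtain n where n: "M \<le> n" "h n \<le> e" using assms[OF \<open>0 < e\<close>] by blast
  let ?V = "{w. set w \<subseteq> D \<and> length w = n}"
  have "hausdorff_content f \<delta> (cantor_set b D) \<le> of_nat (card ?V) * ennreal (\<phi> n)"
  proof (rule content_le_words)
    show "finite ?V" by (rule finite_lists_length_eq[OF D_finite])
    show "1 / real b ^ n \<le> \<delta>" using M n by (simp add: less_imp_le)
  qed (auto simp: cantor_set_eq)
  also have "\<dots> = ennreal (h n)"
    using phi_pos[of n] by (simp add: card_lists_length_eq D_finite h_def ennreal_of_nat_eq_real_of_nat flip: ennreal_mult)
  also have "\<dots> \<le> ennreal e" using n by (intro ennreal_leI)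
  finally show "hausdorff_content f \<delta> (cantor_set b D) \<le> ennreal e" .
qed

text \<open>The summand \<open>e\<close> is needed for sets of diameter 0, which cost nothing.\<close>

lemma words_for_set:
  assumes hmono: "mono h"
    and U: "bounded U" "diameter U \<le> 1 / real b ^ (l + 2)" and "0 < e"
  shows "\<exists>u v. l < length u \<and> l < length v \<and>
    ennreal (\<phi> (length u)) \<le> of_nat (card D) * hf_cost f U + ennreal e \<and>
    ennreal (\<phi> (length v)) \<le> of_nat (card D) * hf_cost f U + ennreal e \<and>
    (\<forall>s. (\<forall>n. s n \<in> D) \<longrightarrow> expansion b s \<in> U \<longrightarrow> map s [0..<length u] = u \<or> map s [0..<length v] = v)"
proof -
  have dist: "\<bar>x - y\<bar> \<le> diameter U" if "x \<in> U" "y \<in> U" for x y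
    using diameter_bounded_bound[OF U(1) that] by (simp add: dist_real_def)
  have "\<exists>l'>l. diameter U < 1 / real b ^ l' \<and> ennreal (\<phi> l') \<le> of_nat (card D) * hf_cost f U + ennreal e"
  proof (cases "diameter U = 0")
    case True
    have "eventually (\<lambda>l'. \<phi> l' < e \<and> l < l') sequentially"
      using order_tendstoD(2)[OF phi_tendsto \<open>0 < e\<close>] eventually_gt_at_top[of l] by (rule eventually_conj)
    then obtain l' where "\<phi> l' < e" "l < l'" by (auto simp: eventually_sequentially)
    then show ?thesis using True by (intro exI[of _ l']) (simp add: hf_cost_def ennreal_leI)
  next
    case False
    then have pos: "0 < diameter U" using diameter_ge_0[OF U(1)] by simp
    obtain M where "\<forall>j\<ge>M. 1 / real b ^ j < diameter U" using scale_eventually[OF pos] by blast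
    then have ex: "\<exists>j. 1 / real b ^ j \<le> diameter U" by (meson less_imp_le order_refl)
    \<comment> \<open>\<open>l' = j - 1\<close> is the last generation whose scale exceeds the
      diameter. Going back from \<open>j\<close> to \<open>l'\<close> multiplies the price by at
      most \<open>card D\<close>, because \<open>h\<close> increases; the \<open>+ 2\<close> in the
      assumption gives \<open>l < l'\<close>.\<close>
    define j where "j = (LEAST j. 1 / real b ^ j \<le> diameter U)"
    have j: "1 / real b ^ j \<le> diameter U" unfolding j_def using ex by (rule LeastI_ex)
    have "l + 2 \<le> j"
    proof (rule ccontr)
      assume "\<not> l + 2 \<le> j"
      then have "1 / real b ^ (l + 2) < 1 / real b ^ j"
        using b_ge by (intro divide_strict_left_mono power_strict_increasing) auto
      then show False using j U(2) by simp
    qed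
    then obtain l' where l': "j = Suc l'" "l < l'" by (cases j) auto
    have "\<not> 1 / real b ^ l' \<le> diameter U"
      using not_less_Least[of l' "\<lambda>j. 1 / real b ^ j \<le> diameter U"] l' by (simp add: j_def)
    moreover have "\<phi> l' \<le> real (card D) * \<phi> j"
      using monoD[OF hmono, of l' j] D_card by (simp add: h_def l')
    moreover have "\<phi> j \<le> f (diameter U)"
      unfolding \<phi>_def by (rule f_le[OF _ j]) simp
    ultimately have "diameter U < 1 / real b ^ l'" "\<phi> l' \<le> real (card D) * f (diameter U)"
      by (auto intro: order.trans[OF _ mult_left_mono])
    then have "ennreal (\<phi> l') \<le> of_nat (card D) * hf_cost f U"
      using False f_pos[OF pos]
      by (auto simp: hf_cost_def ennreal_of_nat_eq_real_of_nat intro!: ennreal_leI simp flip: ennreal_mult)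
    then have "ennreal (\<phi> l') \<le> of_nat (card D) * hf_cost f U + ennreal e"
      by (rule order.trans) simp
    then show ?thesis using \<open>diameter U < 1 / real b ^ l'\<close> l' by blast
  qed
  then obtain l' where l': "l < l'" "diameter U < 1 / real b ^ l'"
    "ennreal (\<phi> l') \<le> of_nat (card D) * hf_cost f U + ennreal e" by blast
  have "\<exists>u v. length u = l' \<and> length v = l' \<and>
    (\<forall>s. (\<forall>n. s n \<in> D) \<longrightarrow> expansion b s \<in> U \<longrightarrow> map s [0..<l'] = u \<or> map s [0..<l'] = v)"
    by (rule small_set_two_prefixes[OF b_ge D_sub]) (use dist l'(2) le_less_trans in blast)
  then show ?thesis using l'(1,3) by metis
qed

end

section \<open>Points with infinitely many runs: null complement or infinite measure\<close>

locale coded_cantor_runs = coded_cantor_set b D f + words D z A k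
  for b :: nat and D :: "nat set" and f :: "real \<Rightarrow> real" and z :: nat and A :: "nat set" and k :: "nat \<Rightarrow> nat" +
  fixes W :: "real set"
  assumes runs_in_W: "\<And>s. (\<And>n. s n \<in> D) \<Longrightarrow> infinite {n \<in> A. run s n} \<Longrightarrow> expansion b s \<in> W"
begin

text \<open>A point outside \<open>W\<close> has no run from some stage \<open>M\<close> on, so its
  initial words lie in \<open>avoid M n\<close>. By \<open>avoid_small\<close> their proportion
  becomes arbitrarily small, and \<open>bdd\<close> turns small proportion into small cost. The
  complement is thus a countable union of null sets.\<close>

lemma measure_full_of_bounded:
  assumes bdd: "\<And>l. h l \<le> H" and div: "\<not> summable (\<lambda>n. if n \<in> A then 1 / real N ^ k n else 0)"
  shows "hausdorff_measure f (W \<inter> cantor_set b D) = hausdorff_measure f (cantor_set b D)"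
proof (rule hausdorff_measure_Int_eq)
  define Z where "Z M = expansion b ` {s. (\<forall>j. s j \<in> D) \<and> (\<forall>n\<in>A. M \<le> n \<longrightarrow> \<not> run s n)}" for M
  have H0: "0 < H" using bdd[of 0] h_pos[of 0] by simp
  have "cantor_set b D - W \<subseteq> (\<Union>M. Z M)"
  proof
    fix x assume "x \<in> cantor_set b D - W"
    then obtain s where s: "\<forall>j. s j \<in> D" "x = expansion b s" "x \<notin> W" by (auto simp: cantor_set_eq)
    then have "finite {n \<in> A. run s n}" using runs_in_W[of s] by blast
    then obtain M where "\<forall>n\<in>{n \<in> A. run s n}. n < M" using finite_nat_set_iff_bounded by blast
    then have "\<forall>n\<in>A. M \<le> n \<longrightarrow> \<not> run s n" using not_le by blast
    then have "s \<in> {s. (\<forall>j. s j \<in> D) \<and> (\<forall>n\<in>A. M \<le> n \<longrightarrow> \<not> run s n)}" using s(1) by simp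
    then have "x \<in> Z M" unfolding Z_def s(2) by (rule imageI)
    then show "x \<in> (\<Union>M. Z M)" by (rule UN_I[OF UNIV_I])
  qed
  then have "hausdorff_measure f (cantor_set b D - W) \<le> hausdorff_measure f (\<Union>M. Z M)"
    by (rule hausdorff_measure_mono)
  also have "\<dots> = 0"
  proof (rule hausdorff_measure_Union_null, rule hausdorff_measure_zeroI)
    fix M and \<delta> e :: real assume "0 < \<delta>" "0 < e"
    obtain n1 where n1: "\<forall>l\<ge>n1. 1 / real b ^ l < \<delta>" using scale_eventually[OF \<open>0 < \<delta>\<close>] by blast
    have "0 < e / H" using \<open>0 < e\<close> H0 by simp
    then obtain n where n: "n1 \<le> n" "real (card (avoid M n)) \<le> e / H * real N ^ n"
      using avoid_small[OF div] by blast
    have "hausdorff_content f \<delta> (Z M) \<le> of_nat (card (avoid M n)) * ennreal (\<phi> n)"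
    proof (rule content_le_words)
      show "Z M \<subseteq> expansion b ` {s. (\<forall>j. s j \<in> D) \<and> map s [0..<n] \<in> avoid M n}"
        unfolding Z_def by (intro image_mono Collect_mono conjI impI) (auto intro!: map_in_avoid)
      show "1 / real b ^ n \<le> \<delta>" using n1 n by (simp add: less_imp_le)
    qed simp
    also have "\<dots> = ennreal (real (card (avoid M n)) * \<phi> n)"
      using phi_pos[of n] by (simp add: ennreal_of_nat_eq_real_of_nat ennreal_mult)
    also have "\<dots> \<le> ennreal e"
    proof (rule ennreal_leI)
      have "real (card (avoid M n)) * \<phi> n \<le> e / H * real N ^ n * \<phi> n"
        using n(2) phi_pos[of n] by (intro mult_right_mono) auto
      also have "\<dots> = e / H * h n" by (simp add: h_def)
      also have "\<dots> \<le> e / H * H" using bdd \<open>0 < e / H\<close> by (intro mult_left_mono) auto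
      finally show "real (card (avoid M n)) * \<phi> n \<le> e" using H0 by simp
    qed
    finally show "hausdorff_content f \<delta> (Z M) \<le> ennreal e" .
  qed
  finally show "hausdorff_measure f (cantor_set b D - W) = 0" by simp
qed

text \<open>In a cheaper cover, each set can be replaced by the two words of
  \<open>words_for_set\<close>. These words are cheap enough for
  \<open>avoid_cover_infinite_runs\<close>, which produces a point of \<open>W\<close> outside the
  cover.\<close>

lemma content_lower_bound:
  assumes hmono: "mono h" and unbdd: "\<And>B. \<exists>l. B \<le> h l"
    and k4: "\<And>n. n \<in> A \<Longrightarrow> 4 \<le> k n"
    and div: "\<not> summable (\<lambda>n. if n \<in> A then real N ^ n * \<phi> (n + k n) else 0)"
  shows "ennreal (h l / (32 * real N)) \<le> hausdorff_content f (1 / real b ^ (l + 2)) (W \<inter> cantor_set b D)"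
  unfolding hausdorff_content_def
proof (rule INF_greatest)
  fix U :: "nat \<Rightarrow> real set"
  assume "U \<in> {U. W \<inter> cantor_set b D \<subseteq> (\<Union>i. U i) \<and> (\<forall>i. bounded (U i) \<and> diameter (U i) \<le> 1 / real b ^ (l + 2))}"
  then have cover: "W \<inter> cantor_set b D \<subseteq> (\<Union>i. U i)"
    and U: "\<And>i. bounded (U i)" "\<And>i. diameter (U i) \<le> 1 / real b ^ (l + 2)" by auto
  let ?c = "\<Sum>i. hf_cost f (U i)"
  show "ennreal (h l / (32 * real N)) \<le> ?c"
  proof (rule ccontr)
    assume "\<not> ?thesis"
    then have c: "?c \<le> ennreal (h l / (32 * real N))" by simp
    \<comment> \<open>The errors sum up to \<open>h l / 64\<close>. With the factor \<open>N\<close>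
      from \<open>words_for_set\<close> and two words per set, the total is at most
      \<open>2 * (h l / 32 + h l / 64) = 3 * h l / 32\<close>, below the required
      \<open>h l / 8\<close>.\<close>
    define e where "e i = h l / 64 * (1/2) ^ Suc i" for i :: nat
    have e: "0 < e i" for i using h_pos[of l] by (simp add: e_def)
    let ?C = "\<lambda>i. of_nat N * hf_cost f (U i) + ennreal (e i)"
    have "\<forall>i. \<exists>u v. l < length u \<and> l < length v \<and> ennreal (\<phi> (length u)) \<le> ?C i \<and> ennreal (\<phi> (length v)) \<le> ?C i \<and>
      (\<forall>s. (\<forall>n. s n \<in> D) \<longrightarrow> expansion b s \<in> U i \<longrightarrow> map s [0..<length u] = u \<or> map s [0..<length v] = v)"
      by (intro allI words_for_set hmono U e)
    then obtain u v where uv: "\<And>i. l < length (u i)" "\<And>i. l < length (v i)"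
      "\<And>i. ennreal (\<phi> (length (u i))) \<le> ?C i" "\<And>i. ennreal (\<phi> (length (v i))) \<le> ?C i"
      "\<And>i s. (\<forall>n. s n \<in> D) \<Longrightarrow> expansion b s \<in> U i \<Longrightarrow>
        map s [0..<length (u i)] = u i \<or> map s [0..<length (v i)] = v i"
      by metis
    define w where "w i = (if even i then u (i div 2) else v (i div 2))" for i
    have C: "(\<Sum>i. ?C i) \<le> ennreal (3 * h l / 64)"
    proof -
      have "(\<Sum>i. ennreal (e i)) = ennreal (h l / 64)"
        using sums_mult[OF power_half_series, of "h l / 64"] h_pos[of l]
        by (intro suminf_ennreal_eq) (auto simp: e_def)
      then have "(\<Sum>i. ?C i) = of_nat N * ?c + ennreal (h l / 64)"
        by (simp add: suminf_add[symmetric])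
      also have "\<dots> \<le> of_nat N * ennreal (h l / (32 * real N)) + ennreal (h l / 64)"
        by (intro add_right_mono mult_left_mono c) simp
      also have "\<dots> = ennreal (3 * h l / 64)"
        using h_pos[of l] D_card
        by (simp add: ennreal_of_nat_eq_real_of_nat flip: ennreal_mult ennreal_plus)
      finally show ?thesis .
    qed
    have "(\<Sum>i. ennreal (\<phi> (length (w i)))) \<le> ennreal (3 * h l / 32)"
    proof (rule suminf_le_const)
      fix n
      have "(\<Sum>i<n. ennreal (\<phi> (length (w i)))) \<le> (\<Sum>i<2*n. ennreal (\<phi> (length (w i))))"
        by (rule sum_mono2) auto
      also have "\<dots> \<le> (\<Sum>i<n. 2 * ?C i)"
      proof (induction n)
        case (Suc n)
        have "ennreal (\<phi> (length (u n))) + ennreal (\<phi> (length (v n))) \<le> 2 * ?C n"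
          using add_mono[OF uv(3)[of n] uv(4)[of n]] by (simp only: mult_2)
        then show ?case using add_mono[OF Suc.IH] by (simp add: w_def add.assoc)
      qed simp
      also have "\<dots> \<le> (\<Sum>i. 2 * ?C i)" by (rule sum_le_suminf) auto
      also have "\<dots> = 2 * (\<Sum>i. ?C i)" by (rule ennreal_suminf_cmult)
      also have "\<dots> \<le> ennreal 2 * ennreal (3 * h l / 64)"
        using mult_left_mono[OF C, of 2] by simp
      also have "\<dots> = ennreal (3 * h l / 32)" using h_pos[of l] by (subst ennreal_mult[symmetric]) auto
      finally show "(\<Sum>i<n. ennreal (\<phi> (length (w i)))) \<le> ennreal (3 * h l / 32)" .
    qed auto
    also have "\<dots> < ennreal (real N ^ l * \<phi> l / 8)"
      using h_pos[of l] by (intro ennreal_lessI) (auto simp: h_def mult.commute)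
    finally have total: "(\<Sum>i. ennreal (\<phi> (length (w i)))) < ennreal (real N ^ l * \<phi> l / 8)" .
    have len: "l < length (w i)" for i using uv(1,2) by (simp add: w_def)
    obtain s where s: "\<And>j. s j \<in> D" "infinite {n \<in> A. run s n}" "\<And>i. map s [0..<length (w i)] \<noteq> w i"
      using avoid_cover_infinite_runs[OF phi_pos phi_anti monoD[OF hmono, unfolded h_def] unbdd[unfolded h_def] k4 div len total]
      by metis
    have "expansion b s \<in> W \<inter> cantor_set b D"
      using runs_in_W[OF s(1,2)] s(1) by (auto simp: cantor_set_eq)
    then obtain i where "expansion b s \<in> U i" using cover by blast
    then show False using uv(5)[of s i] s(1) s(3)[of "2 * i"] s(3)[of "2 * i + 1"] by (auto simp: w_def)
  qed
qed

lemma measure_infinite_of_unbounded: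
  assumes hmono: "mono h" and unbdd: "\<And>B. \<exists>l. B \<le> h l"
    and k4: "\<And>n. n \<in> A \<Longrightarrow> 4 \<le> k n"
    and div: "\<not> summable (\<lambda>n. if n \<in> A then real N ^ n * \<phi> (n + k n) else 0)"
  shows "hausdorff_measure f (W \<inter> cantor_set b D) = top"
proof (rule ccontr)
  assume "\<not> ?thesis"
  then obtain B where B: "hausdorff_measure f (W \<inter> cantor_set b D) = ennreal B" "0 \<le> B"
    by (cases "hausdorff_measure f (W \<inter> cantor_set b D)") auto
  have N0: "0 < real N" using D_card by simp
  obtain l where l: "32 * real N * (B + 1) \<le> h l" using unbdd by blast
  have "ennreal (h l / (32 * real N)) \<le> hausdorff_measure f (W \<inter> cantor_set b D)"
    unfolding hausdorff_measure_def
    using content_lower_bound[OF hmono unbdd k4 div, of l] by (rule order.trans) (auto intro!: SUP_upper)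
  then have "h l / (32 * real N) \<le> B" using B by (simp add: ennreal_le_iff)
  moreover have "B + 1 \<le> h l / (32 * real N)" using l N0 by (simp add: field_simps)
  ultimately show False by simp
qed

end

section \<open>Approximation by fractions with denominator a power of b\<close>

context coded_cantor_set
begin

lemma Min_Max_D: "Min D \<le> Max D" "Max D < b" "d \<in> D \<Longrightarrow> Min D \<le> d" "d \<in> D \<Longrightarrow> d \<le> Max D"
proof -
  have ne: "D \<noteq> {}" using D_card by auto
  show "Min D \<le> Max D" using ne D_finite by simp
  show "Max D < b" using Max_in[OF D_finite ne] D_sub by auto
qed (use D_finite in auto)

text \<open>A run of the digit \<open>z\<close> brings the point close to the left end (\<open>z = Min D\<close>) or the right end
  (\<open>z = Max D\<close>) of its piece of generation \<open>n\<close>, and this end has distance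
  \<open>m / ((b - 1) b\<^sup>n)\<close> from the nearest \<open>p / b\<^sup>n\<close>. The digit before the run ensures
  \<open>p \<ge> 1\<close> when \<open>z = 0\<close>.\<close>

lemma runs_in_W_set:
  assumes "words D z A k"
    and z: "z = Min D \<and> m = Min D \<or> z = Max D \<and> m = b - 1 - Max D"
    and k: "\<And>n. n \<in> A \<Longrightarrow> 1 / real b ^ (n + k n) < \<psi> n - real m / ((real b - 1) * real b ^ n)"
    and s: "\<forall>n. s n \<in> D" and inf: "infinite {n \<in> A. words.run z k s n}"
  shows "expansion b s \<in> W_set b \<psi>"
proof -
  interpret words D z A k by fact
  let ?x = "expansion b s"
  have ex: "\<exists>p. 1 \<le> p \<and> \<bar>?x - real p / real b ^ n\<bar> < \<psi> n" if n: "n \<in> A" "run s n" for n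
  proof -
    let ?E = "expansion b (\<lambda>j. s (n + j))" and ?a = "head b s n"
    have z_less: "z < b" using z_in D_sub by auto
    have x: "?x = (real ?a + ?E) / real b ^ n" by (rule expansion_shift[OF b_ge digit_less[OF s]])
    have E: "0 \<le> ?E" "?E \<le> 1" using expansion_unit_D[of "\<lambda>j. s (n + j)"] s by auto
    have run: "\<bar>?E - real z / (real b - 1)\<bar> \<le> 1 / real b ^ k n"
      by (rule expansion_run[OF b_ge digit_less z_less]) (use s n in \<open>auto simp: run_def\<close>)
    have psi: "(real m / (real b - 1) + 1 / real b ^ k n) / real b ^ n < \<psi> n"
      using k[OF n(1)] by (simp add: add_divide_distrib power_add mult.commute)
    from z show ?thesis
    proof
      assume z: "z = Min D \<and> m = Min D"
      have "s (n - 1) \<noteq> Min D" using n(2) z unfolding run_def by blast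
      then have "Min D < s (n - 1)" using Min_Max_D(3)[of "s (n - 1)"] s by simp
      moreover obtain n' where "n = Suc n'" using A_pos[OF n(1)] by (cases n) auto
      ultimately have a: "1 \<le> ?a" by simp
      have "\<bar>?x - real ?a / real b ^ n\<bar> = ?E / real b ^ n"
        using E by (simp add: x add_divide_distrib)
      also have "\<dots> \<le> (real m / (real b - 1) + 1 / real b ^ k n) / real b ^ n"
        using run z by (intro divide_right_mono) auto
      also note psi
      finally show ?thesis using a by blast
    next
      assume z: "z = Max D \<and> m = b - 1 - Max D"
      then have "real m = real b - 1 - real z" using Min_Max_D(2) b_ge by auto
      then have m: "real m / (real b - 1) = 1 - real z / (real b - 1)"
        using b_ge by (simp add: field_simps)
      \<comment> \<open>The right end of the piece lies \<open>m / ((b - 1) * b ^ n)\<close> below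
        the next grid point, hence the numerator \<open>?a + 1\<close>.\<close>
      have "\<bar>?x - real (?a + 1) / real b ^ n\<bar> = \<bar>(?E - 1) / real b ^ n\<bar>"
        unfolding x by (simp flip: diff_divide_distrib)
      also have "\<dots> = (1 - ?E) / real b ^ n" using E by (simp add: abs_divide)
      also have "\<dots> \<le> (real m / (real b - 1) + 1 / real b ^ k n) / real b ^ n"
        using run m by (intro divide_right_mono) auto
      also note psi
      finally show ?thesis by (intro exI[of _ "?a + 1"]) simp
    qed
  qed
  let ?S = "{(p :: nat, n :: nat). 1 \<le> p \<and> 1 \<le> n \<and> \<bar>?x - real p / real b ^ n\<bar> < \<psi> n}"
  have "{n \<in> A. run s n} \<subseteq> snd ` ?S"
  proof
    fix n assume n: "n \<in> {n \<in> A. run s n}"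
    then obtain p where "1 \<le> p" "\<bar>?x - real p / real b ^ n\<bar> < \<psi> n" using ex by blast
    then have "(p, n) \<in> ?S" using n A_pos by simp
    then show "n \<in> snd ` ?S" by (rule rev_image_eqI) simp
  qed
  then have "infinite ?S" using inf finite_surj by blast
  then show ?thesis using expansion_unit_D[OF s] by (simp add: W_set_def)
qed

section \<open>The convergent case: points near the ends of the pieces\<close>

text \<open>Let \<open>a\<close> be the head. The distance to \<open>p / b ^ n\<close> is at least
  \<open>E / b ^ n\<close> if \<open>p \<le> a\<close> and at least \<open>(1 - E) / b ^ n\<close>
  otherwise. Either way the grid point is at least \<open>m / ((b - 1) * b ^ n)\<close> away from
  the end of the piece on its side, and subtracting this gap leaves a bound for the distance to that
  end.\<close>

lemma near_grid_point:
  assumes s: "\<forall>n. s n \<in> D" and m: "m \<le> Min D" "m \<le> b - 1 - Max D"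
    and p: "\<bar>expansion b s - real p / real b ^ n\<bar> < \<psi>"
  defines "E \<equiv> expansion b (\<lambda>j. s (n + j))" and "r \<equiv> \<psi> - real m / ((real b - 1) * real b ^ n)"
  shows "0 < r"
    and "(E - real (Min D) / (real b - 1)) / real b ^ n \<le> r \<or> (real (Max D) / (real b - 1) - E) / real b ^ n \<le> r"
proof -
  let ?a = "head b s n"
  have b1: "0 < real b - 1" using b_ge by simp
  have E: "real (Min D) / (real b - 1) \<le> E" "E \<le> real (Max D) / (real b - 1)"
    unfolding E_def by (rule expansion_bounds[OF b_ge]; use s Min_Max_D in auto)+
  have x: "expansion b s = (real ?a + E) / real b ^ n"
    unfolding E_def by (rule expansion_shift[OF b_ge digit_less[OF s]])
  have r: "r = \<psi> - (real m / (real b - 1)) / real b ^ n" by (simp add: r_def)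
  have "real m / (real b - 1) \<le> real (Min D) / (real b - 1)" using m(1) b1 by (intro divide_right_mono) auto
  moreover have "real m \<le> real b - 1 - real (Max D)" using m(2) Min_Max_D(2) by auto
  then have "real m / (real b - 1) \<le> (real b - 1 - real (Max D)) / (real b - 1)"
    using b1 by (intro divide_right_mono) auto
  then have "real m / (real b - 1) \<le> 1 - real (Max D) / (real b - 1)"
    using b1 by (simp add: diff_divide_distrib)
  ultimately have *: "(E - real (Min D) / (real b - 1)) / real b ^ n \<le> (E - real m / (real b - 1)) / real b ^ n"
    "(real (Max D) / (real b - 1) - E) / real b ^ n \<le> ((1 - E) - real m / (real b - 1)) / real b ^ n"
    by (intro divide_right_mono; simp)+
  have **: "0 \<le> (E - real (Min D) / (real b - 1)) / real b ^ n"
    "0 \<le> (real (Max D) / (real b - 1) - E) / real b ^ n"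
    using E by (auto intro!: divide_nonneg_pos)
  have "0 < r \<and> ((E - real (Min D) / (real b - 1)) / real b ^ n \<le> r \<or> (real (Max D) / (real b - 1) - E) / real b ^ n \<le> r)"
  proof (cases "p \<le> ?a")
    case True
    have "E / real b ^ n \<le> (real ?a + E - real p) / real b ^ n"
      using True by (intro divide_right_mono) auto
    also have "\<dots> < \<psi>" using p by (simp add: x diff_divide_distrib)
    finally have "(E - real m / (real b - 1)) / real b ^ n < r" by (simp add: r diff_divide_distrib)
    then show ?thesis using *(1) **(1) by linarith
  next
    case False
    have "(1 - E) / real b ^ n \<le> (real p - (real ?a + E)) / real b ^ n"
      using False by (intro divide_right_mono) auto
    also have "\<dots> < \<psi>" using p by (simp add: x diff_divide_distrib)
    finally have "((1 - E) - real m / (real b - 1)) / real b ^ n < r"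
      by (simp add: r diff_divide_distrib)
    then show ?thesis using *(2) **(2) by linarith
  qed
  then show "0 < r" "(E - real (Min D) / (real b - 1)) / real b ^ n \<le> r \<or> (real (Max D) / (real b - 1) - E) / real b ^ n \<le> r"
    by blast+
qed

text \<open>Each of the \<open>card D ^ n\<close> pieces contributes two sets, its points within
  \<open>r\<close> of the left and of the right end. Their diameter is at most \<open>r\<close>,
  which bounds the cost, and at most \<open>1 / b ^ n\<close>, which makes them admissible at scale
  \<open>\<delta>\<close>.\<close>

lemma content_near_grid:
  fixes \<psi> :: real
  assumes m: "m \<le> Min D" "m \<le> b - 1 - Max D" and d: "1 / real b ^ n \<le> \<delta>"
  defines "r \<equiv> \<psi> - real m / ((real b - 1) * real b ^ n)"
  shows "hausdorff_content f \<delta> {x \<in> cantor_set b D. \<exists>p::nat. \<bar>x - real p / real b ^ n\<bar> < \<psi>}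
    \<le> ennreal (if 0 < r then 2 * (f r * real (card D) ^ n) else 0)"
    (is "hausdorff_content f \<delta> ?E \<le> _")
proof (cases "0 < r")
  case False
  then have empty: "?E = {}" using near_grid_point(1)[OF _ m] by (auto simp: cantor_set_eq r_def)
  have "0 \<le> \<delta>" using d by (rule order.trans[rotated]) simp
  then show ?thesis unfolding empty by simp
next
  case True
  let ?e = "\<lambda>s. expansion b (\<lambda>j. s (n + j))"
  \<comment> \<open>The distance from the point to the left end (\<open>True\<close>) or the right
    end (\<open>False\<close>) of its piece of generation \<open>n\<close>.\<close>
  define side where "side l s = (if l then (?e s - real (Min D) / (real b - 1)) / real b ^ n
      else (real (Max D) / (real b - 1) - ?e s) / real b ^ n)" for l :: bool and s :: "nat \<Rightarrow> nat"
  define X where "X = (\<lambda>(w, l). expansion b ` {s. (\<forall>j. s j \<in> D) \<and> map s [0..<n] = w \<and> side l s \<le> r})"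
  let ?V = "{w. set w \<subseteq> D \<and> length w = n}"
  have fin: "finite ?V" by (rule finite_lists_length_eq[OF D_finite])
  have "hausdorff_content f \<delta> ?E \<le> of_nat (card (?V \<times> (UNIV :: bool set))) * ennreal (f r)"
  proof (rule hausdorff_content_finite_cover)
    show "finite (?V \<times> (UNIV :: bool set))" using fin by simp
    show "0 \<le> \<delta>" using d by (rule order.trans[rotated]) simp
    show "?E \<subseteq> (\<Union>i\<in>?V \<times> UNIV. X i)"
    proof
      fix x assume "x \<in> ?E"
      then obtain s p where s: "\<forall>j. s j \<in> D" "x = expansion b s" "\<bar>expansion b s - real p / real b ^ n\<bar> < \<psi>"
        by (auto simp: cantor_set_eq)
      have "side True s \<le> r \<or> side False s \<le> r"
        using near_grid_point(2)[OF s(1) m s(3)] by (simp add: side_def r_def)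
      then obtain l where "side l s \<le> r" by blast
      then have "x \<in> X (map s [0..<n], l)" using s unfolding X_def by auto
      moreover have "(map s [0..<n], l) \<in> ?V \<times> UNIV" using s by auto
      ultimately show "x \<in> (\<Union>i\<in>?V \<times> UNIV. X i)" by blast
    qed
    fix i assume "i \<in> ?V \<times> (UNIV :: bool set)"
    obtain w l where i: "i = (w, l)" by force
    have "X i \<subseteq> {0..1}" using expansion_unit_D by (auto simp: X_def i)
    then have bd: "bounded (X i)" by (rule bounded_subset[rotated]) simp
    have dist: "\<bar>x - y\<bar> \<le> r \<and> \<bar>x - y\<bar> \<le> 1 / real b ^ n" if xy: "x \<in> X i" "y \<in> X i" for x y
    proof -
      obtain s t where st: "\<forall>j. s j \<in> D" "\<forall>j. t j \<in> D" "map s [0..<n] = map t [0..<n]"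
        "x = expansion b s" "y = expansion b t" "side l s \<le> r" "side l t \<le> r"
        using xy by (auto simp: X_def i)
      have eq: "\<bar>x - y\<bar> = \<bar>?e s - ?e t\<bar> / real b ^ n"
        unfolding st(4,5) by (rule expansion_same_prefix[OF b_ge digit_less[OF st(1)] digit_less[OF st(2)] st(3)])
      have "\<bar>?e s - ?e t\<bar> \<le> 1"
        using expansion_unit_D[of "\<lambda>j. s (n + j)"] expansion_unit_D[of "\<lambda>j. t (n + j)"] st
        by (auto simp: abs_le_iff)
      then have "\<bar>x - y\<bar> \<le> 1 / real b ^ n" unfolding eq by (intro divide_right_mono) auto
      have mM: "real (Min D) / (real b - 1) \<le> ?e s" "?e s \<le> real (Max D) / (real b - 1)"
        "real (Min D) / (real b - 1) \<le> ?e t" "?e t \<le> real (Max D) / (real b - 1)"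
        by (rule expansion_bounds[OF b_ge]; use st Min_Max_D in auto)+
      then have nn: "0 \<le> side l s" "0 \<le> side l t"
        by (auto simp: side_def intro!: divide_nonneg_pos)
      have "\<bar>x - y\<bar> = \<bar>side l s - side l t\<bar>"
        unfolding eq side_def by (auto simp: abs_divide abs_minus_commute simp flip: diff_divide_distrib)
      then have "\<bar>x - y\<bar> \<le> r" using nn st(6,7) by linarith
      with \<open>\<bar>x - y\<bar> \<le> 1 / real b ^ n\<close> show ?thesis by blast
    qed
    have "diameter (X i) \<le> r" by (rule diameter_le) (use dist True in auto)
    moreover have "diameter (X i) \<le> 1 / real b ^ n" by (rule diameter_le) (use dist in auto)
    ultimately show "bounded (X i) \<and> diameter (X i) \<le> \<delta> \<and> hf_cost f (X i) \<le> ennreal (f r)"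
      using bd d hf_cost_le[OF f_mono True _ bd] by auto
  qed
  also have "\<dots> = ennreal (2 * (f r * real (card D) ^ n))"
    using f_pos[OF True]
    by (simp add: card_cartesian_product card_lists_length_eq D_finite ennreal_of_nat_eq_real_of_nat
        mult_ac flip: ennreal_mult)
  finally show ?thesis using True by simp
qed

text \<open>A Borel-Cantelli argument: the points approximated at stages from \<open>M\<close> on
  cover the set for every \<open>M\<close>, and by \<open>content_near_grid\<close> their cost is at
  most twice a tail of the series.\<close>

lemma measure_zero_of_summable:
  fixes \<psi> :: "nat \<Rightarrow> real"
  assumes m: "m \<le> Min D" "m \<le> b - 1 - Max D"
  defines "r \<equiv> \<lambda>n. \<psi> n - real m / ((real b - 1) * real b ^ n)"
  assumes sm: "summable (\<lambda>n. if 1 \<le> n \<and> 0 < r n then f (r n) * real (card D) ^ n else 0)"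
  shows "hausdorff_measure f (W_set b \<psi> \<inter> cantor_set b D) = 0"
proof (rule hausdorff_measure_zeroI)
  fix \<delta> e :: real assume "0 < \<delta>" "0 < e"
  define g where "g n = (if 1 \<le> n \<and> 0 < r n then f (r n) * real (card D) ^ n else 0)" for n
  have g: "summable g" "0 \<le> g n" for n
    using sm f_pos[of "r n"] by (auto simp: g_def[abs_def] less_imp_le)
  obtain M1 where M1: "\<forall>l\<ge>M1. 1 / real b ^ l < \<delta>" using scale_eventually[OF \<open>0 < \<delta>\<close>] by blast
  have "eventually (\<lambda>M. (\<Sum>n. g (n + M)) < e / 2 \<and> max M1 1 \<le> M) sequentially"
    using order_tendstoD(2)[OF suminf_exist_split2[OF g(1)], of "e / 2"] \<open>0 < e\<close>
      eventually_ge_at_top[of "max M1 1"] by (auto intro: eventually_conj)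
  then obtain M where M: "(\<Sum>n. g (n + M)) < e / 2" "M1 \<le> M" "1 \<le> M"
    by (auto simp: eventually_sequentially)
  let ?E = "\<lambda>n. {x \<in> cantor_set b D. \<exists>p::nat. \<bar>x - real p / real b ^ n\<bar> < \<psi> n}"
  have "W_set b \<psi> \<inter> cantor_set b D \<subseteq> (\<Union>n. ?E (n + M))"
  proof
    fix x assume x: "x \<in> W_set b \<psi> \<inter> cantor_set b D"
    let ?S = "{(p :: nat, n :: nat). 1 \<le> p \<and> 1 \<le> n \<and> \<bar>x - real p / real b ^ n\<bar> < \<psi> n}"
    have "\<exists>p n. (p, n) \<in> ?S \<and> M \<le> n"
    proof (rule ccontr)
      assume c: "\<not> ?thesis"
      \<comment> \<open>For each \<open>n\<close> only finitely many \<open>p\<close> come close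
        enough to \<open>x\<close>, so infinitely many pairs require arbitrarily large
        \<open>n\<close>.\<close>
      have "?S \<subseteq> (\<Union>n<M. {..nat \<lceil>(x + \<psi> n) * real b ^ n\<rceil>} \<times> {n})"
      proof
        fix q assume q: "q \<in> ?S"
        obtain p n where pn: "q = (p, n)" by force
        let ?c = "(x + \<psi> n) * real b ^ n"
        have "n < M"
        proof (rule ccontr)
          assume "\<not> n < M"
          then have "(p, n) \<in> ?S \<and> M \<le> n" using q pn by simp
          then show False using c by blast
        qed
        have "\<bar>x - real p / real b ^ n\<bar> < \<psi> n" using q pn by simp
        then have "real p / real b ^ n < x + \<psi> n" by linarith
        then have "real p < ?c"
          by (rule pos_divide_less_eq[THEN iffD1, rotated]) simp
        then have "real p \<le> real (nat \<lceil>?c\<rceil>)"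
          using of_nat_ceiling[of ?c] by (rule order.trans[OF less_imp_le])
        then have "(p, n) \<in> {..nat \<lceil>?c\<rceil>} \<times> {n}" by simp
        then show "q \<in> (\<Union>n<M. {..nat \<lceil>(x + \<psi> n) * real b ^ n\<rceil>} \<times> {n})"
          unfolding pn using \<open>n < M\<close> by (intro UN_I[of n]) simp_all
      qed
      then have "finite ?S" by (rule finite_subset) auto
      then show False using x by (simp add: W_set_def)
    qed
    then obtain p n where "(p, n) \<in> ?S" "M \<le> n" by blast
    then have "x \<in> ?E ((n - M) + M)" using x by auto
    then show "x \<in> (\<Union>n. ?E (n + M))" by (rule UN_I[OF UNIV_I])
  qed
  then have "hausdorff_content f \<delta> (W_set b \<psi> \<inter> cantor_set b D) \<le> hausdorff_content f \<delta> (\<Union>n. ?E (n + M))"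
    by (rule hausdorff_content_mono)
  also have "\<dots> \<le> (\<Sum>n. hausdorff_content f \<delta> (?E (n + M)))"
    by (rule hausdorff_content_countable_subadditive)
  also have "\<dots> \<le> (\<Sum>n. ennreal (2 * g (n + M)))"
  proof (rule suminf_le)
    fix n
    have "1 / real b ^ (n + M) \<le> \<delta>" using M1 M(2) by (simp add: less_imp_le)
    from content_near_grid[OF m this, of "\<psi> (n + M)"]
    show "hausdorff_content f \<delta> (?E (n + M)) \<le> ennreal (2 * g (n + M))"
      using M(3) by (simp add: g_def r_def split: if_splits)
  qed auto
  also have "\<dots> = ennreal (\<Sum>n. 2 * g (n + M))"
    using g by (intro suminf_ennreal2) (auto intro: summable_mult summable_ignore_initial_segment)
  also have "\<dots> \<le> ennreal e"
    using M(1) g(1) by (intro ennreal_leI) (simp add: suminf_mult summable_ignore_initial_segment)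
  finally show "hausdorff_content f \<delta> (W_set b \<psi> \<inter> cantor_set b D) \<le> ennreal e" .
qed

section \<open>The divergent case: choice of the run lengths\<close>

text \<open>The constants \<open>c\<close> and \<open>K\<close> record that \<open>h\<close> stays
  away from 0 and falls by at most a fixed factor per step. This suffices to carry the divergence
  over to the series of run costs; then the bounded or the unbounded case applies.\<close>

lemma measure_full_of_not_summable:
  fixes \<psi> :: "nat \<Rightarrow> real"
  assumes m: "m = min (Min D) (b - 1 - Max D)"
  defines "r \<equiv> \<lambda>n. \<psi> n - real m / ((real b - 1) * real b ^ n)"
  assumes div: "\<not> summable (\<lambda>n. if 1 \<le> n \<and> 0 < r n then f (r n) * real (card D) ^ n else 0)"
    and c: "0 < c" "\<And>l. c \<le> h l" and K: "0 \<le> K" "\<And>l. h l \<le> K * h (Suc l)"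
    and cases: "(\<exists>H. \<forall>l. h l \<le> H) \<or> mono h"
  shows "hausdorff_measure f (W_set b \<psi> \<inter> cantor_set b D) = hausdorff_measure f (cantor_set b D)"
proof -
  define z where "z = (if m = Min D then Min D else Max D)"
  define A where "A = {n. 1 \<le> n \<and> 0 < r n}"
  \<comment> \<open>The shortest run whose error is below \<open>r n\<close>, subject to the lower
    bound 4 that \<open>good_step\<close> requires.\<close>
  define k where "k n = (LEAST j. 4 \<le> j \<and> 1 / real b ^ (n + j) < r n)" for n
  have N0: "0 < real (card D)" using D_card by simp
  have k: "4 \<le> k n" "1 / real b ^ (n + k n) < r n" if n: "n \<in> A" for n
  proof -
    obtain M where "\<forall>l\<ge>M. 1 / real b ^ l < r n" using scale_eventually[of "r n"] n by (auto simp: A_def)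
    then have "4 \<le> M + 4 \<and> 1 / real b ^ (n + (M + 4)) < r n" by simp
    then have "4 \<le> k n \<and> 1 / real b ^ (n + k n) < r n" unfolding k_def by (rule LeastI)
    then show "4 \<le> k n" "1 / real b ^ (n + k n) < r n" by auto
  qed
  have ne: "D \<noteq> {}" using D_card by auto
  interpret words D z A k
  proof
    show "z \<in> D" unfolding z_def using Min_in Max_in D_finite ne by auto
    show "1 \<le> k n" if "n \<in> A" for n using k(1)[OF that] by simp
  qed (auto simp: D_finite D_card A_def)
  have zm: "z = Min D \<and> m = Min D \<or> z = Max D \<and> m = b - 1 - Max D"
    using m by (auto simp: z_def min_def)
  interpret coded_cantor_runs b D f z A k "W_set b \<psi>"
  proof
    fix s assume "\<And>n. s n \<in> D" "infinite {n \<in> A. run s n}"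
    then show "expansion b s \<in> W_set b \<psi>"
      using k(2) by (intro runs_in_W_set[OF words_axioms zm]) (auto simp: r_def)
  qed
  have div_phi: "\<not> summable (\<lambda>n. if n \<in> A then real N ^ n * \<phi> (n + k n) else 0)"
  proof
    let ?y = "\<lambda>n. if n \<in> A then real N ^ n * \<phi> (n + k n) else 0"
    assume sm: "summable ?y"
    \<comment> \<open>A stage with \<open>k n = 4\<close> contributes at least
      \<open>c / N ^ 4\<close>, so convergence leaves only longer runs eventually. For these,
      minimality gives \<open>r n \<le> 1 / b ^ (n + k n - 1)\<close>, and the lost step costs the
      factor \<open>K * N\<close>.\<close>
    have "eventually (\<lambda>n. ?y n < c / real N ^ 4) sequentially"
      using order_tendstoD(2)[OF summable_LIMSEQ_zero[OF sm], of "c / real N ^ 4"] c(1) N0 by simp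
    then have ev: "eventually (\<lambda>n. norm (if 1 \<le> n \<and> 0 < r n then f (r n) * real N ^ n else 0)
        \<le> K * real N * ?y n) sequentially"
    proof (rule eventually_mono)
      fix n assume y: "?y n < c / real N ^ 4"
      show "norm (if 1 \<le> n \<and> 0 < r n then f (r n) * real N ^ n else 0) \<le> K * real N * ?y n"
      proof (cases "n \<in> A")
        case True
        have "k n \<noteq> 4"
        proof
          assume 4: "k n = 4"
          have "?y n = h (n + 4) / real N ^ 4" using True 4 N0 by (simp add: h_def power_add)
          then have "c / real N ^ 4 \<le> ?y n" using c(2)[of "n + 4"] by (simp add: divide_right_mono)
          then show False using y by simp
        qed
        then obtain j where j: "k n = Suc j" "4 \<le> j" using k(1)[OF True] by (cases "k n") auto
        have "\<not> 1 / real b ^ (n + j) < r n"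
          using not_less_Least[of j "\<lambda>j. 4 \<le> j \<and> 1 / real b ^ (n + j) < r n"] j by (simp add: k_def)
        then have "f (r n) \<le> \<phi> (n + j)"
          unfolding \<phi>_def using True by (intro f_le) (auto simp: A_def)
        then have "f (r n) * real N ^ n \<le> \<phi> (n + j) * real N ^ n"
          by (rule mult_right_mono) simp
        also have "\<dots> = h (n + j) / real N ^ j" using N0 by (simp add: h_def power_add)
        also have "\<dots> \<le> K * h (Suc (n + j)) / real N ^ j" using K(2) by (rule divide_right_mono) simp
        also have "\<dots> = K * real N * ?y n" using True j N0 by (simp add: h_def power_add)
        finally show ?thesis using True f_pos[of "r n"] by (simp add: A_def)
      qed (auto simp: A_def)
    qed
    have "summable (\<lambda>n. K * real N * ?y n)" using sm by (rule summable_mult)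
    from summable_comparison_test_ev[OF ev this] show False using div by simp
  qed
  show ?thesis
  proof (cases "\<exists>H. \<forall>l. h l \<le> H")
    case True
    then obtain H where H: "\<And>l. h l \<le> H" by blast
    have "\<not> summable (\<lambda>n. if n \<in> A then 1 / real N ^ k n else 0)"
    proof
      assume "summable (\<lambda>n. if n \<in> A then 1 / real N ^ k n else 0)"
      then have "summable (\<lambda>n. H * (if n \<in> A then 1 / real N ^ k n else 0))" by (rule summable_mult)
      then have "summable (\<lambda>n. if n \<in> A then real N ^ n * \<phi> (n + k n) else 0)"
      proof (rule summable_comparison_test')
        fix n
        show "norm (if n \<in> A then real N ^ n * \<phi> (n + k n) else 0)
          \<le> H * (if n \<in> A then 1 / real N ^ k n else 0)"
        proof -
          have "real N ^ n * \<phi> (n + k n) = h (n + k n) / real N ^ k n"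
            using N0 by (simp add: h_def power_add)
          also have "\<dots> \<le> H / real N ^ k n" using H by (rule divide_right_mono) simp
          finally show ?thesis using phi_pos[of "n + k n"] by simp
        qed
      qed
      with div_phi show False by contradiction
    qed
    from measure_full_of_bounded[OF H this] show ?thesis .
  next
    case False
    then have hm: "mono h" by (rule mp[OF disj_imp[THEN iffD1, OF cases]])
    have unbdd: "\<exists>l. B \<le> h l" for B
    proof (rule ccontr)
      assume "\<not> ?thesis"
      then have "\<forall>l. h l \<le> B" by (simp add: not_le less_imp_le)
      then show False using False by blast
    qed
    have "hausdorff_measure f (W_set b \<psi> \<inter> cantor_set b D) = top"
      by (rule measure_infinite_of_unbounded[OF hm unbdd k(1) div_phi])
    moreover have "hausdorff_measure f (W_set b \<psi> \<inter> cantor_set b D) \<le> hausdorff_measure f (cantor_set b D)"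
      by (rule hausdorff_measure_mono) simp
    ultimately show ?thesis by (simp add: top_unique)
  qed
qed

end

section \<open>The dichotomy for both directions of monotonicity\<close>

theorem theorem1p3:
  fixes b :: nat and D :: "nat set" and f :: "real \<Rightarrow> real" and \<psi> :: "nat \<Rightarrow> real"
    and \<gamma> :: real and m :: nat
  assumes "b \<ge> 3"
    and "D \<subseteq> {0..<b}" and "2 \<le> card D" and "card D \<le> b - 1"
    and "\<gamma> = ln (real (card D)) / ln (real b)"
    and "m = min (Min D) (b - 1 - Max D)"
    and "dimension_function f"
    and "mono_on {0<..} (\<lambda>r. r powr (-\<gamma>) * f r) \<or> antimono_on {0<..} (\<lambda>r. r powr (-\<gamma>) * f r)"
    and "\<forall>n. \<psi> n > 0"
  defines "g \<equiv> (\<lambda>n. if n \<ge> 1 \<and> \<psi> n > real m / ((real b - 1) * real b ^ n)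
                  then f (\<psi> n - real m / ((real b - 1) * real b ^ n)) * real b powr (real n * \<gamma>)
                  else 0)"
  shows "(summable g \<longrightarrow> hausdorff_measure f (W_set b \<psi> \<inter> cantor_set b D) = 0)
       \<and> (\<not> summable g \<longrightarrow>
           hausdorff_measure f (W_set b \<psi> \<inter> cantor_set b D) = hausdorff_measure f (cantor_set b D))"
proof -
  interpret coded_cantor_set b D f
    by standard (use assms(1-3,7) in \<open>auto simp: dimension_function_def\<close>)
  have powr_eq: "real b powr (real n * \<gamma>) = real (card D) ^ n" for n
  proof -
    have "ln (real b) \<noteq> 0" using assms(1) by simp
    then have "real b powr (real n * \<gamma>) = exp (real n * ln (real (card D)))"
      using assms(1,5) by (simp add: powr_def)
    then show ?thesis using assms(3) by (simp add: exp_of_nat_mult)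
  qed
  have g_eq: "g = (\<lambda>n. if 1 \<le> n \<and> 0 < \<psi> n - real m / ((real b - 1) * real b ^ n)
      then f (\<psi> n - real m / ((real b - 1) * real b ^ n)) * real (card D) ^ n else 0)"
    unfolding g_def powr_eq by simp
  \<comment> \<open>\<open>h\<close> samples the monotonic function at the scales
    \<open>1 / b ^ l\<close>. These decrease in \<open>l\<close>, so the direction of monotonicity
    is reversed.\<close>
  have h_eq: "h l = (1 / real b ^ l) powr (-\<gamma>) * f (1 / real b ^ l)" for l
  proof -
    have "(1 / real b ^ l) powr (-\<gamma>) = real b powr (real l * \<gamma>)"
      using assms(1) by (simp add: powr_minus powr_divide powr_powr flip: powr_realpow)
    then show ?thesis by (simp add: powr_eq h_def \<phi>_def)
  qed
  have full: "hausdorff_measure f (W_set b \<psi> \<inter> cantor_set b D) = hausdorff_measure f (cantor_set b D)"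
    if ns: "\<not> summable g"
  proof -
    note full = measure_full_of_not_summable[OF assms(6) ns[unfolded g_eq]]
    from assms(8) show ?thesis
    proof
      assume mo: "mono_on {0<..} (\<lambda>r. r powr (-\<gamma>) * f r)"
      then have anti: "h l' \<le> h l" if "l \<le> l'" for l l'
        unfolding h_eq using mono_onD[OF mo _ _ scale_mono[OF that]] by simp
      show ?thesis
      \<comment> \<open>A decreasing \<open>h\<close> either stays between two positive constants or
        tends to 0; in the latter case the whole Cantor set is null and both sides vanish.\<close>
      proof (cases "\<exists>c>0. \<forall>l. c \<le> h l")
        case True
        then obtain c where c: "0 < c" "\<And>l. c \<le> h l" by blast
        have "h l \<le> h 0 / c * h (Suc l)" for l
        proof -
          have "h l \<le> h 0" by (rule anti) simp
          also have "\<dots> = h 0 / c * c" using c(1) by simp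
          also have "\<dots> \<le> h 0 / c * h (Suc l)" using c h_pos[of 0] by (intro mult_left_mono) auto
          finally show ?thesis .
        qed
        moreover have "0 \<le> h 0 / c" using c(1) h_pos[of 0] by simp
        moreover have "\<exists>H. \<forall>l. h l \<le> H" using anti[of 0] by blast
        ultimately show ?thesis using c by (intro full[of c "h 0 / c"]) auto
      next
        case False
        have "hausdorff_measure f (cantor_set b D) = 0"
        proof (rule measure_cantor_zero)
          fix e :: real and M assume "0 < e"
          then obtain l where "h l < e" using False by (meson not_le)
          then have "h (max l M) \<le> e" using anti[of l "max l M"] by simp
          then show "\<exists>n\<ge>M. h n \<le> e" by (intro exI[of _ "max l M"]) simp
        qed
        moreover have "hausdorff_measure f (W_set b \<psi> \<inter> cantor_set b D) \<le> hausdorff_measure f (cantor_set b D)"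
          by (rule hausdorff_measure_mono) simp
        ultimately show ?thesis by simp
      qed
    next
      assume am: "antimono_on {0<..} (\<lambda>r. r powr (-\<gamma>) * f r)"
      then have hm: "h l \<le> h l'" if "l \<le> l'" for l l'
        unfolding h_eq using monotone_onD[OF am _ _ scale_mono[OF that]] by simp
      then show ?thesis
        using h_pos[of 0] by (intro full[of "h 0" 1]) (auto intro!: monoI)
    qed
  qed
  moreover have "hausdorff_measure f (W_set b \<psi> \<inter> cantor_set b D) = 0" if "summable g"
    using measure_zero_of_summable[of m \<psi>] that assms(6) unfolding g_eq by simp
  ultimately show ?thesis by blast
qed

end
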